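(* Let $\Gamma_1,\dots,\Gamma_k$ be graphs with $d$ vertices (loops and multiple edges allowed) and let $W_1\le S_d,\dots,W_k\le S_d$ be their automorphism groups, respectively. Let $r$ be a natural number and suppose that $W_1$ has a normal solvable subgroup $R$ of order $r$ such that the factor-group $W_1/R$ is a cyclic group of order relatively prime to $r$. Let $\pi\colon W_1\to K$ be a one-dimensional character of $W_1$ with kernel $R$. Then the number of all superpositions of $\Gamma_1,\dots,\Gamma_k$ whose automorphism groups are of order dividing $r$ coincides with $$ N\bigl(Z(\pi;p_1,\dots,p_d)\ast Z(1_{W_2};p_1,\dots,p_d)\ast\cdots\ast Z(1_{W_k};p_1,\dots,p_d)\bigr). $$
   Context: $K$ is an algebraically closed field of characteristic zero; $d,k\ge1$; $S_d$ is the symmetric group; a one-dimensional character of a group $W$ is a homomorphism $W\to K^*$; $1_W$ is the trivial character. The graphs have vertex set $\{1,\dots,d\}$, and the automorphism group of a graph is the group of vertex permutations preserving edge multiplicities. Superpositions of $\Gamma_1,\dots,\Gamma_k$ are the ways of placing the graphs on a common set of $d$ vertices, up to simultaneous relabelling of the vertices; that is, the equivalence classes of tuples $(a_1,\dots,a_k)\in S_d\times\cdots\times S_d$ (where $a_m$ represents the placed copy $a_m\Gamma_m$) under $(a_1,\dots,a_k)\sim(b_1,\dots,b_k)$ iff there are $\zeta\in S_d$ and $w_m\in W_m$ with $b_m=\zeta a_mw_m$ for all $m$. The automorphism group of the superposition represented by $(a_1,\dots,a_k)$ is $a_1W_1a_1^{-1}\cap\cdots\cap a_kW_ka_k^{-1}$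 (well defined up to conjugation in $S_d$). For $W\le S_d$ and a one-dimensional character $\chi$ of $W$, $Z(\chi;p_1,\dots,p_d)=|W|^{-1}\sum_{\sigma\in W}\chi(\sigma)p_1^{c_1(\sigma)}\cdots p_d^{c_d(\sigma)}$, where $c_s(\sigma)$ is the number of cycles of length $s$ of $\sigma$ and $p_s=\sum_{i\ge0}x_i^s$ are the power sums in $x_0,x_1,\dots$. With $R^d$ the group of generalized characters of $S_d$, $\Lambda^d$ the group of homogeneous degree $d$ symmetric functions with integer coefficients in $x_0,x_1,\dots$, and $ch\colon R^d\to\Lambda^d$ the (bijective) characteristic map $ch(u)=\frac1{d!}\sum_{\sigma\in S_d}u(\sigma)p_1^{c_1(\sigma)}\cdots p_d^{c_d(\sigma)}$, one has $Z(\chi;p_1,\dots,p_d)=ch(\mathrm{ind}_W^{S_d}(\chi))$, and the internal product on $\Lambda^d$ is defined by $ch(u)\ast ch(v)=ch(uv)$. For a polynomial $A$ in $p_1,\dots,p_d$, $N(A)$ is the sum of its coefficients. *)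

theory Defs
  imports
    "HOL-Library.Poly_Mapping"
    "HOL-Library.Multiset"
    "HOL-Library.Uprod"
    "HOL-Library.FuncSet"
    "HOL-Computational_Algebra.Polynomial"
    "HOL-Combinatorics.Orbits"
    "HOL-Algebra.Sym_Groups"
    "HOL-Algebra.Elementary_Groups"
    "Jordan_Normal_Form.Matrix"
begin

section \<open>Formal series in countably many variables\<close>

text \<open>A monomial in the variables \<open>x\<^sub>0, x\<^sub>1, \<dots>\<close> is a finitely supported exponent
  function, and a series assigns a coefficient to every monomial.\<close>

typedef 'a mseries = "UNIV :: ((nat \<Rightarrow>\<^sub>0 nat) \<Rightarrow> 'a) set"
  morphisms mcoeff MSeries by simp

lemma mcoeff_MSeries [simp]: "mcoeff (MSeries f) = f"
  by (simp add: MSeries_inverse)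

lemma mseries_eqI: "(\<And>m. mcoeff F m = mcoeff G m) \<Longrightarrow> F = G"
  by (simp add: mcoeff_inject[symmetric] fun_eq_iff)

definition splits :: "(nat \<Rightarrow>\<^sub>0 nat) \<Rightarrow> ((nat \<Rightarrow>\<^sub>0 nat) \<times> (nat \<Rightarrow>\<^sub>0 nat)) set" where
  "splits m = {(a, b). a + b = m}"

lemma finite_splits [simp]: "finite (splits m)"
proof -
  let ?f = "\<lambda>(a, b). (restrict (Poly_Mapping.lookup a) (Poly_Mapping.keys m), restrict (Poly_Mapping.lookup b) (Poly_Mapping.keys m))"
  let ?B = "PiE (Poly_Mapping.keys m) (\<lambda>i. {..Poly_Mapping.lookup m i})"
  have le: "Poly_Mapping.lookup a i \<le> Poly_Mapping.lookup m i" "Poly_Mapping.lookup b i \<le> Poly_Mapping.lookup m i"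
    if "a + b = m" for a b i
    using that by (auto simp: lookup_add)
  have out: "Poly_Mapping.lookup a i = 0" if "a = p \<or> a = q" "p + q = m" "i \<notin> Poly_Mapping.keys m" for a p q i
    using le[OF that(2), of i] that by (auto simp: in_keys_iff)
  have ext: "a = a'"
    if "restrict (Poly_Mapping.lookup a) (Poly_Mapping.keys m) = restrict (Poly_Mapping.lookup a') (Poly_Mapping.keys m)"
       "\<And>i. i \<notin> Poly_Mapping.keys m \<Longrightarrow> Poly_Mapping.lookup a i = 0" "\<And>i. i \<notin> Poly_Mapping.keys m \<Longrightarrow> Poly_Mapping.lookup a' i = 0" for a a'
  proof (rule poly_mapping_eqI)
    fix i show "Poly_Mapping.lookup a i = Poly_Mapping.lookup a' i"
      using that by (cases "i \<in> Poly_Mapping.keys m") (metis restrict_apply', simp)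
  qed
  have "inj_on ?f (splits m)"
    unfolding splits_def inj_on_def
    by clarsimp (metis ext out)
  moreover have "?f ` splits m \<subseteq> ?B \<times> ?B"
    unfolding splits_def using le by (auto simp: PiE_def)
  moreover have "finite (?B \<times> ?B)"
    by (intro finite_cartesian_product finite_PiE) auto
  ultimately show ?thesis
    using finite_imageD finite_subset by blast
qed

instantiation mseries :: (comm_ring_1) comm_ring_1
begin

definition "0 = MSeries (\<lambda>_. 0)"
definition "1 = MSeries (\<lambda>m. if m = 0 then 1 else 0)"
definition "F + G = MSeries (\<lambda>m. mcoeff F m + mcoeff G m)"
definition "- F = MSeries (\<lambda>m. - mcoeff F m)"
definition "F - G = MSeries (\<lambda>m. mcoeff F m - mcoeff G m)"
definition "F * G = MSeries (\<lambda>m. \<Sum>(a, b)\<in>splits m. mcoeff F a * mcoeff G b)"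

instance
proof
  fix F G H :: "'a mseries"
  note defs = zero_mseries_def one_mseries_def plus_mseries_def uminus_mseries_def
    minus_mseries_def times_mseries_def
  show "F + G + H = F + (G + H)" "F + G = G + F" "0 + F = F" "- F + F = 0" "F - G = F + - G"
    by (auto intro!: mseries_eqI simp: defs)
  show "(0 :: 'a mseries) \<noteq> 1"
    by (auto simp: defs MSeries_inject fun_eq_iff)
  show "(F + G) * H = F * H + G * H"
    by (rule mseries_eqI) (simp add: defs distrib_right sum.distrib case_prod_unfold)
  show "F * G = G * F"
    unfolding defs
    by (rule arg_cong[where f = MSeries], rule ext,
        rule sum.reindex_bij_witness[where i = prod.swap and j = prod.swap])
       (auto simp: splits_def ac_simps)
  show "1 * F = F"
  proof (rule mseries_eqI)
    fix m
    have "mcoeff (1 * F) m = (\<Sum>x\<in>splits m. if x = (0, m) then mcoeff F m else 0)"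
      unfolding defs by (auto intro!: sum.cong simp: splits_def)
    also have "\<dots> = mcoeff F m"
      by (subst sum.delta) (simp, simp add: splits_def)
    finally show "mcoeff (1 * F) m = mcoeff F m" .
  qed
  show "F * G * H = F * (G * H)"
  proof (rule mseries_eqI)
    fix m
    have "mcoeff (F * G * H) m =
        (\<Sum>(x, y)\<in>Sigma (splits m) (\<lambda>x. splits (fst x)).
          mcoeff F (fst y) * mcoeff G (snd y) * mcoeff H (snd x))"
      unfolding defs
      by (simp add: case_prod_unfold sum_distrib_right sum.Sigma)
    also have "\<dots> = (\<Sum>(x, y)\<in>Sigma (splits m) (\<lambda>x. splits (snd x)).
          mcoeff F (fst x) * (mcoeff G (fst y) * mcoeff H (snd y)))"
      by (rule sum.reindex_bij_witness
            [where i = "\<lambda>(x, y). ((fst x + fst y, snd y), (fst x, fst y))"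
               and j = "\<lambda>(x, y). ((fst y, snd y + snd x), (snd y, snd x))"])
         (auto simp: splits_def ac_simps)
    also have "\<dots> = mcoeff (F * (G * H)) m"
      unfolding defs
      by (simp add: case_prod_unfold sum_distrib_left sum.Sigma)
    finally show "mcoeff (F * G * H) m = mcoeff (F * (G * H)) m" .
  qed
qed

end

definition mconst :: "'a::zero \<Rightarrow> 'a mseries" where
  "mconst c = MSeries (\<lambda>m. if m = 0 then c else 0)"

text \<open>\<open>p\<^sub>s = \<Sum>i\<ge>0. x\<^sub>i\<^sup>s\<close>; only \<open>s \<ge> 1\<close> is meaningful.\<close>

definition psum :: "nat \<Rightarrow> 'a::zero_neq_one mseries" where
  "psum s = MSeries (\<lambda>m. if \<exists>i. m = Poly_Mapping.single i s then 1 else 0)"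


section \<open>Polynomials in the power sums\<close>

text \<open>A polynomial in indeterminates indexed by \<open>nat\<close> has type
  \<open>(nat \<Rightarrow>\<^sub>0 nat) \<Rightarrow>\<^sub>0 'a\<close>; the indeterminate with index \<open>s\<close> stands for \<open>p\<^sub>s\<close>.\<close>

definition psum_subst :: "((nat \<Rightarrow>\<^sub>0 nat) \<Rightarrow>\<^sub>0 'a::comm_ring_1) \<Rightarrow> 'a mseries" where
  "psum_subst A =
     (\<Sum>e\<in>Poly_Mapping.keys A. mconst (Poly_Mapping.lookup A e) *
     (\<Prod>s\<in>Poly_Mapping.keys e. psum s ^ Poly_Mapping.lookup e s))"

text \<open>The expression of a symmetric function as a polynomial in \<open>p\<^sub>1, \<dots>, p\<^sub>d\<close>. It is unique because
  the power sums are algebraically independent in characteristic zero.\<close>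

definition psum_poly :: "nat \<Rightarrow> 'a::comm_ring_1 mseries \<Rightarrow> ((nat \<Rightarrow>\<^sub>0 nat) \<Rightarrow>\<^sub>0 'a)" where
  "psum_poly d F =
     (THE A. (\<forall>e\<in>Poly_Mapping.keys A. Poly_Mapping.keys e \<subseteq> {1..d}) \<and> psum_subst A = F)"

definition coeff_sum :: "('b \<Rightarrow>\<^sub>0 'a::comm_ring_1) \<Rightarrow> 'a" where
  "coeff_sum A = (\<Sum>e\<in>Poly_Mapping.keys A. Poly_Mapping.lookup A e)"


section \<open>Characters and the characteristic map\<close>

definition units_group :: "'a::field monoid" where
  "units_group = \<lparr>carrier = UNIV - {0}, mult = (*), one = 1\<rparr>"

definition subgrp :: "nat \<Rightarrow> (nat \<Rightarrow> nat) set \<Rightarrow> (nat \<Rightarrow> nat) monoid" where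
  "subgrp d W = (sym_group d)\<lparr>carrier := W\<rparr>"

definition linear_char :: "nat \<Rightarrow> (nat \<Rightarrow> nat) set \<Rightarrow> ((nat \<Rightarrow> nat) \<Rightarrow> 'a::field) \<Rightarrow> bool" where
  "linear_char d W \<chi> \<longleftrightarrow> \<chi> \<in> hom (subgrp d W) units_group"

text \<open>Characters of \<open>S\<^sub>d\<close> afforded by matrix representations over the field \<open>'a\<close>. Class functions are
  normalised to be \<open>undefined\<close> outside \<open>S\<^sub>d\<close>.\<close>

definition sym_chars :: "nat \<Rightarrow> ((nat \<Rightarrow> nat) \<Rightarrow> 'a::field) set" where
  "sym_chars d = {\<lambda>\<sigma>\<in>carrier (sym_group d). \<Sum>i<n. \<rho> \<sigma> $$ (i, i) | n \<rho>.
     \<rho> \<in> hom (sym_group d) (units_of (ring_mat TYPE('a) n ()))}"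

definition gen_chars :: "nat \<Rightarrow> ((nat \<Rightarrow> nat) \<Rightarrow> 'a::field) set" where
  "gen_chars d = {\<lambda>\<sigma>\<in>carrier (sym_group d). u \<sigma> - v \<sigma> | u v. u \<in> sym_chars d \<and> v \<in> sym_chars d}"

definition cycle_count :: "nat \<Rightarrow> nat \<Rightarrow> (nat \<Rightarrow> nat) \<Rightarrow> nat" where
  "cycle_count d s \<sigma> = card {C \<in> orbit \<sigma> ` {1..d}. card C = s}"

definition cycle_index ::
  "nat \<Rightarrow> (nat \<Rightarrow> nat) set \<Rightarrow> ((nat \<Rightarrow> nat) \<Rightarrow> 'a::field) \<Rightarrow> 'a mseries" where
  "cycle_index d W \<chi> =
     mconst (1 / of_nat (card W)) *
     (\<Sum>\<sigma>\<in>W. mconst (\<chi> \<sigma>) * (\<Prod>s=1..d. psum s ^ cycle_count d s \<sigma>))"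

definition ch :: "nat \<Rightarrow> ((nat \<Rightarrow> nat) \<Rightarrow> 'a::field_char_0) \<Rightarrow> 'a mseries" where
  "ch d u =
     mconst (1 / fact d) *
     (\<Sum>\<sigma>\<in>carrier (sym_group d). mconst (u \<sigma>) * (\<Prod>s=1..d. psum s ^ cycle_count d s \<sigma>))"

text \<open>The map \<^term>\<open>ch d\<close> is injective on \<^term>\<open>gen_chars d\<close>, with image the
  homogeneous symmetric functions of degree \<open>d\<close> with integer coefficients. The internal product is
  meaningful for arguments in that image.\<close>

definition internal_prod :: "nat \<Rightarrow> 'a::field_char_0 mseries \<Rightarrow> 'a mseries \<Rightarrow> 'a mseries" where
  "internal_prod d F G =
     (let u = inv_into (gen_chars d) (ch d) F; v = inv_into (gen_chars d) (ch d) G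
      in ch d (\<lambda>\<sigma>\<in>carrier (sym_group d). u \<sigma> * v \<sigma>))"


section \<open>Graphs and superpositions\<close>

text \<open>An undirected graph on the vertices \<open>1, \<dots>, d\<close> is the multiset of its edges, an edge
  being an unordered pair of possibly equal vertices.\<close>

definition is_graph :: "nat \<Rightarrow> nat uprod multiset \<Rightarrow> bool" where
  "is_graph d E \<longleftrightarrow> (\<forall>e\<in>#E. set_uprod e \<subseteq> {1..d})"

definition graph_aut :: "nat \<Rightarrow> nat uprod multiset \<Rightarrow> (nat \<Rightarrow> nat) set" where
  "graph_aut d E = {\<sigma> \<in> carrier (sym_group d).
     \<forall>i\<in>{1..d}. \<forall>j\<in>{1..d}. count E (Upair (\<sigma> i) (\<sigma> j)) = count E (Upair i j)}"

text \<open>Below \<open>W m\<close> is the automorphism group of the \<open>m\<close>-th graph, and the tuple \<open>a\<close> places a copy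
  \<open>a\<^sub>m \<Gamma>\<^sub>m\<close> of each graph on the common vertex set.\<close>

definition sup_rel ::
  "nat \<Rightarrow> nat \<Rightarrow> (nat \<Rightarrow> (nat \<Rightarrow> nat) set) \<Rightarrow> ((nat \<Rightarrow> nat \<Rightarrow> nat) \<times> (nat \<Rightarrow> nat \<Rightarrow> nat)) set" where
  "sup_rel d k W = {(a, b).
     a \<in> {1..k} \<rightarrow>\<^sub>E carrier (sym_group d) \<and> b \<in> {1..k} \<rightarrow>\<^sub>E carrier (sym_group d) \<and>
     (\<exists>\<zeta>\<in>carrier (sym_group d). \<exists>w. \<forall>m\<in>{1..k}. w m \<in> W m \<and> b m = \<zeta> \<circ> a m \<circ> w m)}"

definition superpositions ::
  "nat \<Rightarrow> nat \<Rightarrow> (nat \<Rightarrow> (nat \<Rightarrow> nat) set) \<Rightarrow> (nat \<Rightarrow> nat \<Rightarrow> nat) set set" where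
  "superpositions d k W = ({1..k} \<rightarrow>\<^sub>E carrier (sym_group d)) // sup_rel d k W"

definition sup_aut ::
  "nat \<Rightarrow> (nat \<Rightarrow> (nat \<Rightarrow> nat) set) \<Rightarrow> (nat \<Rightarrow> nat \<Rightarrow> nat) \<Rightarrow> (nat \<Rightarrow> nat) set" where
  "sup_aut k W a = (\<Inter>m\<in>{1..k}. (\<lambda>w. a m \<circ> w \<circ> inv' (a m)) ` W m)"

text \<open>The order of the automorphism group depends only on the superposition.\<close>

lemma card_sup_aut_cong:
  assumes ab: "(a, b) \<in> sup_rel d k W"
    and W: "\<And>m. m \<in> {1..k} \<Longrightarrow> subgroup (W m) (sym_group d)"
  shows "card (sup_aut k W b) = card (sup_aut k W a)"
proof -
  obtain z w where z: "z permutes {1..d}"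
    and w: "\<And>m. m \<in> {1..k} \<Longrightarrow> w m \<in> W m \<and> b m = z \<circ> a m \<circ> w m"
    and a: "\<And>m. m \<in> {1..k} \<Longrightarrow> a m permutes {1..d}"
    using ab unfolding sup_rel_def sym_group_carrier[symmetric] mem_Collect_eq case_prod_conv PiE_iff
    by blast
  define f where "f = (\<lambda>g. z \<circ> g \<circ> inv' z)"
  have bz: "bij z" using z by (rule permutes_bij)
  have inj: "inj f"
    by (rule inj_on_inverseI[where g = "\<lambda>g. inv' z \<circ> g \<circ> z"])
       (simp add: f_def fun_eq_iff bij_is_inj[OF bz])
  have eq: "(\<lambda>v. b m \<circ> v \<circ> inv' (b m)) ` W m = f ` (\<lambda>v. a m \<circ> v \<circ> inv' (a m)) ` W m"
    if m: "m \<in> {1..k}" for m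
  proof -
    interpret S: subgroup "W m" "sym_group d" by (rule W[OF m])
    interpret G: group "sym_group d" by (rule sym_group_is_group)
    have wm: "w m \<in> W m" using w[OF m] by simp
    have pw: "w m permutes {1..d}" using subsetD[OF S.subset wm] by (simp only: sym_group_carrier)
    have bw: "bij (w m)" and ba: "bij (a m)" using pw a[OF m] by (auto intro: permutes_bij)
    have "inv\<^bsub>sym_group d\<^esub> (w m) \<in> W m" using wm by (rule S.m_inv_closed)
    moreover have "inv\<^bsub>sym_group d\<^esub> (w m) = inv' (w m)"
      using pw by (intro G.inv_equality)
        (simp_all add: sym_group_carrier sym_group_mult sym_group_one permutes_inv permutes_inv_o)
    ultimately have iw: "inv' (w m) \<in> W m" by metis
    have cl: "x \<circ> y \<in> W m" if "x \<in> W m" "y \<in> W m" for x y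
      using S.m_closed[OF that] by (simp add: sym_group_mult)
    have ib: "inv' (b m) = inv' (w m) \<circ> inv' (a m) \<circ> inv' z"
      using w[OF m] bz ba bw by (simp add: o_inv_distrib bij_comp comp_assoc)
    have 1: "b m \<circ> v \<circ> inv' (b m) = f (a m \<circ> (w m \<circ> v \<circ> inv' (w m)) \<circ> inv' (a m))" for v
      unfolding ib using w[OF m] by (simp add: f_def comp_assoc)
    have 2: "(\<lambda>v. w m \<circ> v \<circ> inv' (w m)) ` W m = W m"
    proof (intro equalityI subsetI)
      fix x assume x: "x \<in> W m"
      have "x = w m \<circ> (inv' (w m) \<circ> x \<circ> w m) \<circ> inv' (w m)"
        using bw by (simp add: fun_eq_iff bij_is_surj surj_f_inv_f)
      then show "x \<in> (\<lambda>v. w m \<circ> v \<circ> inv' (w m)) ` W m"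
        using cl[OF cl[OF iw x] wm] by blast
    qed (auto intro: cl wm iw)
    have "(\<lambda>v. b m \<circ> v \<circ> inv' (b m)) ` W m
        = (\<lambda>x. f (a m \<circ> x \<circ> inv' (a m))) ` (\<lambda>v. w m \<circ> v \<circ> inv' (w m)) ` W m"
      by (simp add: 1 image_image)
    then show ?thesis by (simp add: 2 image_image)
  qed
  show ?thesis
  proof (cases "k = 0")
    case False
    then have "sup_aut k W b = f ` sup_aut k W a"
      unfolding sup_aut_def using eq inj
      by (subst image_INT[where C = UNIV and j = 1]) auto
    then show ?thesis using inj by (simp add: card_image inj_on_subset)
  qed (simp add: sup_aut_def)
qed

end

theory Submission
  imports Defs "HOL-Algebra.Multiplicative_Group"
begin

text \<open>Every cycle index \<open>Z(\<chi>)\<close> is the characteristic of an induced character, and the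
  characteristic map is injective on generalised characters (power sums are algebraically
  independent and permutations of equal cycle type are conjugate), so the internal product is the
  characteristic of the pointwise product \<open>u\<close> of the induced characters. Hence its coefficient sum is
  the multiplicity \<open>1/d! \<Sum>\<^sub>\<sigma> u(\<sigma>)\<close> of the trivial character. Expanding the induced characters turns
  it into a sum over placements \<open>a\<close> of the sums of \<open>\<pi>\<close> over the groups
  \<open>a\<^sub>1\<inverse> Aut(a) a\<^sub>1 \<le> W\<^sub>1\<close>; by orbit counting, every superposition with
  \<open>a\<^sub>1\<inverse> Aut(a) a\<^sub>1 \<le> R\<close> contributes 1 and the others contribute 0. As \<open>|W\<^sub>1/R|\<close> is coprime to
  \<open>r = |R|\<close>, a subgroup of \<open>W\<^sub>1\<close> has order dividing \<open>r\<close> iff it lies in \<open>R\<close>.\<close>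


section \<open>Algebraic independence of the power sums\<close>

text \<open>Two choice operators in the definitions shape the proof. \<open>psum_poly\<close> is a
  definite description, so no coefficient sum can be read off before uniqueness of the polynomial is
  known. \<open>internal_prod\<close> recovers its factors through
  \<open>inv_into (gen_chars d)\<close>, so a formula for a class function is not enough: each
  induced character has to be exhibited as the trace of actual matrices (monomial matrices over a
  transversal), and each pointwise product as the trace of a Kronecker product.

  The weights in the count come from orbit and stabilizer. A superposition with automorphism group A
  consists of d! |W_1| ... |W_k| / |A| placements, and each of them contributes |A| when the
  restricted character is trivial. The whole class thus contributes d! |W_1| ... |W_k| whatever A
  is, and this is exactly what the mean over S_d and the denominators |W_m| of the induced
  characters divide out.\<close>

fun psum_coeff :: "nat list \<Rightarrow> (nat \<Rightarrow>\<^sub>0 nat) \<Rightarrow> nat" where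
  "psum_coeff [] m = (if m = 0 then 1 else 0)"
| "psum_coeff (s # L) m =
     (\<Sum>(a, b)\<in>splits m. (if \<exists>i. a = Poly_Mapping.single i s then 1 else 0) * psum_coeff L b)"

text \<open>Coefficients of products of power sums are natural numbers. Computing them in
  \<open>nat\<close> rules out cancellation, so whether one vanishes becomes a combinatorial
  question; characteristic zero carries the answer back to the field.\<close>

lemma mcoeff_prod_list_psum:
  "mcoeff (prod_list (map psum L)) m = (of_nat (psum_coeff L m) :: 'a::comm_ring_1)"
proof (induction L arbitrary: m)
  case Nil
  then show ?case by (simp add: one_mseries_def)
next
  case (Cons s L)
  then show ?case
    by (auto simp: times_mseries_def psum_def case_prod_unfold intro!: sum.cong)
qed

text \<open>The partition type of a monomial: its nonzero exponents, with the variables carrying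
  them forgotten.\<close>

definition exponents :: "(nat \<Rightarrow>\<^sub>0 nat) \<Rightarrow> nat multiset" where
  "exponents m = image_mset (Poly_Mapping.lookup m) (mset_set (Poly_Mapping.keys m))"

lemma size_exponents: "size (exponents m) = card (Poly_Mapping.keys m)"
  by (simp add: exponents_def)

lemma keys_single_plus:
  fixes b :: "nat \<Rightarrow>\<^sub>0 nat"
  assumes "s > 0"
  shows "Poly_Mapping.keys (Poly_Mapping.single i s + b) = insert i (Poly_Mapping.keys b)"
  using assms by (auto simp: in_keys_iff lookup_add lookup_single when_def split: if_splits)

lemma exponents_single_plus:
  assumes "s > 0" "i \<notin> Poly_Mapping.keys b"
  shows "exponents (Poly_Mapping.single i s + b) = add_mset s (exponents b)"
proof -
  have "image_mset (Poly_Mapping.lookup (Poly_Mapping.single i s + b)) (mset_set (Poly_Mapping.keys b))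
      = image_mset (Poly_Mapping.lookup b) (mset_set (Poly_Mapping.keys b))"
    using assms by (intro image_mset_cong) (auto simp: lookup_add lookup_single when_def)
  then show ?thesis
    using assms by (simp add: exponents_def keys_single_plus lookup_add in_keys_iff)
qed

text \<open>A sum of natural numbers vanishes only if every term does, so one admissible choice of
  the variable for the first factor is enough.\<close>

lemma psum_coeff_Cons_pos_iff:
  "psum_coeff (s # L) m > 0 \<longleftrightarrow> (\<exists>i b. m = Poly_Mapping.single i s + b \<and> psum_coeff L b > 0)"
proof -
  have "psum_coeff (s # L) m = 0 \<longleftrightarrow> \<not> (\<exists>i b. m = Poly_Mapping.single i s + b \<and> psum_coeff L b > 0)"
    unfolding psum_coeff.simps sum_eq_0_iff[OF finite_splits] by (auto simp: splits_def)
  then show ?thesis by (metis gr0I less_numeral_extra(3))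
qed

text \<open>Triangularity of power sums against monomials. Each factor selects one variable; factors
  that select the same variable merge their exponents and lower the number of variables. The maximal
  number is reached only without collisions, and then the exponents are the factors
  themselves.\<close>

lemma psum_coeff_pos_exponents:
  assumes "psum_coeff L m > 0" "\<forall>s\<in>set L. s > 0"
  shows "size (exponents m) \<le> length L"
    and "size (exponents m) = length L \<Longrightarrow> exponents m = mset L"
proof -
  have "size (exponents m) \<le> length L \<and> (size (exponents m) = length L \<longrightarrow> exponents m = mset L)"
    using assms
  proof (induction L arbitrary: m)
    case Nil
    then show ?case by (auto simp: exponents_def split: if_splits)
  next
    case (Cons s L)
    then obtain i b where m: "m = Poly_Mapping.single i s + b" and b: "psum_coeff L b > 0"
      using psum_coeff_Cons_pos_iff by blast
    have IH: "size (exponents b) \<le> length L" "size (exponents b) = length L \<Longrightarrow> exponents b = mset L"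
      using Cons.IH[OF b] Cons.prems by auto
    have s: "s > 0" using Cons.prems by simp
    show ?case
    proof (cases "i \<in> Poly_Mapping.keys b")
      \<comment> \<open>A collision: \<open>m\<close> has the variables of \<open>b\<close>, hence
        at most \<open>length L\<close> of them, and equality with the length of
        \<open>s # L\<close> is impossible.\<close>
      case True
      then show ?thesis using IH s by (auto simp: size_exponents m keys_single_plus insert_absorb)
    next
      case False
      then show ?thesis using IH exponents_single_plus[OF s False] by (simp add: m)
    qed
  qed
  then show "size (exponents m) \<le> length L"
    and "size (exponents m) = length L \<Longrightarrow> exponents m = mset L" by auto
qed

text \<open>Give every factor a fresh variable; there is always one left, since there are infinitely
  many variables and a monomial uses finitely many.\<close>

lemma ex_psum_coeff_pos:
  assumes "\<forall>s\<in>set L. s > 0"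
  shows "\<exists>m. psum_coeff L m > 0 \<and> exponents m = mset L"
  using assms
proof (induction L)
  case Nil
  then show ?case by (intro exI[of _ 0]) (simp add: exponents_def)
next
  case (Cons s L)
  then obtain b where b: "psum_coeff L b > 0" "exponents b = mset L" by auto
  obtain i where i: "i \<notin> Poly_Mapping.keys b"
    using ex_new_if_finite[OF infinite_UNIV_nat finite_keys] by blast
  have "psum_coeff (s # L) (Poly_Mapping.single i s + b) > 0"
    using b psum_coeff_Cons_pos_iff by blast
  then show ?case
    using exponents_single_plus[OF _ i, of s] b Cons.prems by auto
qed

section \<open>Polynomials in the power sums and their uniqueness\<close>

definition psum_monom :: "(nat \<Rightarrow>\<^sub>0 nat) \<Rightarrow> 'a::comm_ring_1 mseries" where
  "psum_monom e = (\<Prod>s\<in>Poly_Mapping.keys e. psum s ^ Poly_Mapping.lookup e s)"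

text \<open>The partition with \<open>e s\<close> parts equal to \<open>s\<close>. It makes a
  monomial in the power sums comparable with the \<open>exponents\<close> of a monomial in the
  variables.\<close>

definition parts :: "(nat \<Rightarrow>\<^sub>0 nat) \<Rightarrow> nat multiset" where
  "parts e = (\<Sum>s\<in>Poly_Mapping.keys e. replicate_mset (Poly_Mapping.lookup e s) s)"

lemma count_parts: "count (parts e) s = Poly_Mapping.lookup e s"
  by (auto simp: parts_def count_sum in_keys_iff)

lemma parts_inject: "parts e = parts e' \<longleftrightarrow> e = e'"
  by (metis count_parts poly_mapping_eqI)

lemma set_mset_parts: "set_mset (parts e) = Poly_Mapping.keys e"
  by (auto simp: in_keys_iff count_parts simp flip: count_greater_zero_iff)

lemma psum_monom_eq_prod_list:
  assumes L: "mset L = parts e"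
  shows "psum_monom e = (prod_list (map psum L) :: 'a::comm_ring_1 mseries)"
proof -
  have "prod_list (map psum L) = prod_mset (image_mset (psum :: _ \<Rightarrow> 'a mseries) (mset L))"
    by (metis mset_map prod_mset_prod_list)
  also have "\<dots> = psum_monom e"
    unfolding L psum_monom_def
    by (simp add: image_prod_mset_multiplicity set_mset_parts count_parts)
  finally show ?thesis by simp
qed

lemma mcoeff_simps:
  "mcoeff (F + G) m = mcoeff F m + mcoeff G m" "mcoeff (F - G) m = mcoeff F m - mcoeff G m"
  "mcoeff 0 m = 0" "mcoeff (- F) m = - mcoeff F m"
  by (simp_all add: plus_mseries_def minus_mseries_def zero_mseries_def uminus_mseries_def)

lemma mcoeff_sum: "mcoeff (sum f A) m = (\<Sum>x\<in>A. mcoeff (f x) m)"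
  by (induction A rule: infinite_finite_induct) (simp_all add: mcoeff_simps)

lemma mcoeff_mconst_mult: "mcoeff (mconst c * F) m = c * mcoeff F m"
proof -
  have "mcoeff (mconst c * F) m = (\<Sum>x\<in>splits m. if x = (0, m) then c * mcoeff F m else 0)"
    unfolding times_mseries_def mconst_def by (auto intro!: sum.cong simp: splits_def)
  also have "\<dots> = c * mcoeff F m"
    by (subst sum.delta) (simp, simp add: splits_def)
  finally show ?thesis .
qed

lemma mconst_0 [simp]: "mconst 0 = 0"
  by (rule mseries_eqI) (simp add: mconst_def mcoeff_simps)

lemma mconst_add: "mconst (a + b) = mconst a + mconst b"
  by (rule mseries_eqI) (simp add: mconst_def mcoeff_simps)

lemma mconst_mult: "mconst (a * b) = mconst a * mconst b"
  by (rule mseries_eqI) (simp add: mcoeff_mconst_mult, simp add: mconst_def)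

lemma mconst_sum: "mconst (sum f A) = (\<Sum>x\<in>A. mconst (f x))"
  by (induction A rule: infinite_finite_induct) (simp_all add: mconst_add)

text \<open>Sums over \<open>keys\<close> are awkward under addition, where keys may cancel; any
  finite superset serves as a common index set.\<close>

lemma psum_subst_conv_sum:
  assumes "finite E" "Poly_Mapping.keys A \<subseteq> E"
  shows "psum_subst A = (\<Sum>e\<in>E. mconst (Poly_Mapping.lookup A e) * psum_monom e)"
  unfolding psum_subst_def psum_monom_def
  using assms by (intro sum.mono_neutral_left) (auto simp: in_keys_iff)

lemma psum_subst_add: "psum_subst (A + B) = psum_subst A + psum_subst B"
proof -
  let ?E = "Poly_Mapping.keys A \<union> Poly_Mapping.keys B"
  have "Poly_Mapping.keys (A + B) \<subseteq> ?E" by (rule keys_add)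
  then show ?thesis
    by (simp add: psum_subst_conv_sum[where E = ?E] lookup_add mconst_add distrib_right sum.distrib)
qed

lemma psum_subst_0 [simp]: "psum_subst 0 = 0"
  by (simp add: psum_subst_def)

lemma psum_subst_sum: "psum_subst (sum f X) = (\<Sum>x\<in>X. psum_subst (f x))"
  by (induction X rule: infinite_finite_induct) (simp_all add: psum_subst_add)

lemma psum_subst_single: "psum_subst (Poly_Mapping.single e c) = mconst c * psum_monom e"
  by (subst psum_subst_conv_sum[of "{e}"]) auto

text \<open>Among the monomials occurring with the largest number of factors, one is detected by the
  coefficient of a monomial in the \<open>x\<^sub>i\<close> that has that number of variables.\<close>

lemma psum_subst_eq_0D:
  fixes A :: "(nat \<Rightarrow>\<^sub>0 nat) \<Rightarrow>\<^sub>0 'a::field_char_0"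
  assumes "psum_subst A = 0" and pos: "\<forall>e\<in>Poly_Mapping.keys A. 0 \<notin> Poly_Mapping.keys e"
  shows "A = 0"
proof (rule ccontr)
  assume "A \<noteq> 0"
  define N where "N = Max ((\<lambda>e. size (parts e)) ` Poly_Mapping.keys A)"
  have ne: "Poly_Mapping.keys A \<noteq> {}" using \<open>A \<noteq> 0\<close> by simp
  have "N \<in> (\<lambda>e. size (parts e)) ` Poly_Mapping.keys A"
    unfolding N_def using ne by (intro Max_in) auto
  then obtain e where e: "e \<in> Poly_Mapping.keys A" "size (parts e) = N" by blast
  have le: "size (parts e') \<le> N" if "e' \<in> Poly_Mapping.keys A" for e'
    unfolding N_def using that by (intro Max_ge) auto
  \<comment> \<open>Any ordering of the parts will do; lists are needed only because
    \<open>psum_coeff\<close> recurses over them.\<close>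
  define L where "L = (\<lambda>e. SOME L. mset L = parts e)"
  have L: "mset (L e') = parts e'" for e'
    unfolding L_def by (rule someI_ex) (rule ex_mset)
  have L_pos: "\<forall>s\<in>set (L e'). s > 0" if "e' \<in> Poly_Mapping.keys A" for e'
  proof -
    have "set (L e') = Poly_Mapping.keys e'"
      by (simp flip: set_mset_mset add: L set_mset_parts)
    then show ?thesis using pos that by (metis gr0I)
  qed
  obtain m where m: "psum_coeff (L e) m > 0" "exponents m = parts e"
    using ex_psum_coeff_pos[OF L_pos[OF e(1)]] L by auto
  \<comment> \<open>The monomial \<open>m\<close> has N variables, while \<open>e'\<close> has at
    most N factors. If \<open>e'\<close> produced \<open>m\<close>, it would have exactly N factors
    without collisions, so its parts would be \<open>exponents m = parts e\<close>.\<close>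
  have z: "psum_coeff (L e') m = 0" if "e' \<in> Poly_Mapping.keys A" "e' \<noteq> e" for e'
  proof (rule ccontr)
    assume "psum_coeff (L e') m \<noteq> 0"
    then have c: "psum_coeff (L e') m > 0" by simp
    have len: "length (L e') = size (parts e')" using L by (metis size_mset)
    have "size (parts e) \<le> size (parts e')"
      using psum_coeff_pos_exponents(1)[OF c L_pos[OF that(1)]] m len by simp
    then have "exponents m = mset (L e')"
      using psum_coeff_pos_exponents(2)[OF c L_pos[OF that(1)]] m len le[OF that(1)] e by simp
    then show False using m L that parts_inject by metis
  qed
  have "0 = mcoeff (psum_subst A) m" using assms by (simp add: mcoeff_simps)
  also have "\<dots> = (\<Sum>e'\<in>Poly_Mapping.keys A. Poly_Mapping.lookup A e' * of_nat (psum_coeff (L e') m))"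
    by (simp add: psum_subst_conv_sum[OF finite_keys subset_refl] mcoeff_sum mcoeff_mconst_mult
        psum_monom_eq_prod_list[OF L] mcoeff_prod_list_psum)
  also have "\<dots> = (\<Sum>e'\<in>{e}. Poly_Mapping.lookup A e' * of_nat (psum_coeff (L e') m))"
    using e z by (intro sum.mono_neutral_right) auto
  \<comment> \<open>The only surviving term is a nonzero coefficient times a positive natural
    number, which is nonzero in characteristic zero.\<close>
  finally show False using m e by (simp add: in_keys_iff)
qed

lemma psum_poly_psum_subst:
  fixes A :: "(nat \<Rightarrow>\<^sub>0 nat) \<Rightarrow>\<^sub>0 'a::field_char_0"
  assumes "\<forall>e\<in>Poly_Mapping.keys A. Poly_Mapping.keys e \<subseteq> {1..d}"
  shows "psum_poly d (psum_subst A) = A"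
  unfolding psum_poly_def
proof (rule the_equality)
  fix B :: "(nat \<Rightarrow>\<^sub>0 nat) \<Rightarrow>\<^sub>0 'a"
  assume B: "(\<forall>e\<in>Poly_Mapping.keys B. Poly_Mapping.keys e \<subseteq> {1..d}) \<and> psum_subst B = psum_subst A"
  have "psum_subst (B - A) + psum_subst A = psum_subst B" by (simp flip: psum_subst_add)
  then have "psum_subst (B - A) = 0" using B by simp
  moreover have "\<forall>e\<in>Poly_Mapping.keys (B - A). 0 \<notin> Poly_Mapping.keys e"
    using keys_diff[of B A] assms B by fastforce
  ultimately show "B = A" using psum_subst_eq_0D by fastforce
qed (use assms in auto)

section \<open>Additivity of the coefficient sum\<close>

lemma coeff_sum_conv_sum:
  assumes "finite E" "Poly_Mapping.keys A \<subseteq> E"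
  shows "coeff_sum A = (\<Sum>e\<in>E. Poly_Mapping.lookup A e)"
  unfolding coeff_sum_def using assms by (intro sum.mono_neutral_left) (auto simp: in_keys_iff)

lemma coeff_sum_add: "coeff_sum (A + B) = coeff_sum A + coeff_sum B"
proof -
  let ?E = "Poly_Mapping.keys A \<union> Poly_Mapping.keys B"
  have "Poly_Mapping.keys (A + B) \<subseteq> ?E" by (rule keys_add)
  then show ?thesis
    by (simp add: coeff_sum_conv_sum[where E = ?E] lookup_add sum.distrib)
qed

lemma coeff_sum_single: "coeff_sum (Poly_Mapping.single e c) = c"
  by (subst coeff_sum_conv_sum[of "{e}"]) auto

lemma coeff_sum_sum: "coeff_sum (sum f X) = (\<Sum>x\<in>X. coeff_sum (f x))"
  by (induction X rule: infinite_finite_induct) (simp_all add: coeff_sum_add, simp_all add: coeff_sum_def)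


section \<open>Permutations with the same cycle type are conjugate\<close>

lemma orbit_conjugate:
  assumes "bij g" "permutation f"
  shows "orbit (g \<circ> f \<circ> inv' g) x = g ` orbit f (inv' g x)"
proof -
  have "g ` orbit f (inv' g x) = orbit (g \<circ> f \<circ> inv' g) (g (inv' g x))"
    using assms by (intro orbit_inverse permutation_self_in_orbit) (simp_all add: bij_is_inj)
  then show ?thesis using assms(1) by (simp add: bij_is_surj surj_f_inv_f)
qed

lemma cycle_count_conjugate:
  assumes g: "g permutes {1..d}" and f: "permutation f"
  shows "cycle_count d s (g \<circ> f \<circ> inv' g) = cycle_count d s f"
proof -
  let ?h = "g \<circ> f \<circ> inv' g"
  have bij: "bij g" using g by (rule permutes_bij)
  have "orbit ?h ` {1..d} = (\<lambda>x. g ` orbit f (inv' g x)) ` {1..d}"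
    by (simp add: orbit_conjugate[OF bij f])
  also have "\<dots> = (\<lambda>x. g ` orbit f x) ` inv' g ` {1..d}"
    by (simp only: image_image)
  also have "inv' g ` {1..d} = {1..d}" by (rule permutes_image[OF permutes_inv[OF g]])
  finally have "orbit ?h ` {1..d} = image g ` orbit f ` {1..d}" by (simp only: image_image)
  then have "{C \<in> orbit ?h ` {1..d}. card C = s} = image g ` {C \<in> orbit f ` {1..d}. card C = s}"
    using card_image[OF inj_on_subset[OF bij_is_inj[OF bij]]] by auto
  moreover have "inj_on (image g) X" for X
    using bij_is_inj[OF bij] by (metis inj_image_eq_iff inj_onI)
  ultimately show ?thesis by (simp add: cycle_count_def card_image)
qed

text \<open>\<open>funpow_dist1 f x x\<close> is the first return time of \<open>x\<close> and
  equals the size of the orbit. The later arguments on cycles use the size, since that is what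
  \<open>cycle_count\<close> sees.\<close>

lemma funpow_cycle_inj:
  assumes f: "permutation f" and "(f ^^ i) x = (f ^^ j) x" "i < card (orbit f x)" "j < card (orbit f x)"
  shows "i = j"
proof -
  let ?n = "funpow_dist1 f x x"
  have x: "x \<in> orbit f x" using f by (rule permutation_self_in_orbit)
  have "orbit f x = (\<lambda>n. (f ^^ n) x) ` {0..<?n}" using x by (rule orbit_conv_funpow_dist1)
  moreover have inj: "inj_on (\<lambda>n. (f ^^ n) x) {0..<?n}" using x by (rule inj_on_funpow_dist1)
  ultimately have "card (orbit f x) = ?n" by (simp add: card_image)
  then show ?thesis using inj assms by (auto simp: inj_on_def)
qed

lemma funpow_card_orbit:
  assumes f: "permutation f"
  shows "(f ^^ card (orbit f x)) x = x"
    and "orbit f x = (\<lambda>n. (f ^^ n) x) ` {0..<card (orbit f x)}"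
proof -
  let ?n = "funpow_dist1 f x x"
  have x: "x \<in> orbit f x" using f by (rule permutation_self_in_orbit)
  have orb: "orbit f x = (\<lambda>n. (f ^^ n) x) ` {0..<?n}" using x by (rule orbit_conv_funpow_dist1)
  then have n: "card (orbit f x) = ?n"
    using inj_on_funpow_dist1[OF x] by (simp add: card_image)
  show "(f ^^ card (orbit f x)) x = x" using funpow_dist1_prop[OF x] by (simp only: n)
  show "orbit f x = (\<lambda>n. (f ^^ n) x) ` {0..<card (orbit f x)}" unfolding n by (rule orb)
qed

text \<open>Match the i-th iterate of \<open>x\<close> with the i-th iterate of \<open>y\<close>.
  Equivariance is then immediate except at the last iterate.\<close>

lemma orbit_bij_equivariant:
  assumes f: "permutation f" and g: "permutation g" and card: "card (orbit f x) = card (orbit g y)"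
  shows "\<exists>h. bij_betw h (orbit f x) (orbit g y) \<and> (\<forall>z\<in>orbit f x. h (f z) = g (h z))"
proof -
  let ?n = "card (orbit f x)"
  let ?F = "\<lambda>n. (f ^^ n) x" and ?G = "\<lambda>n. (g ^^ n) y"
  have F: "bij_betw ?F {0..<?n} (orbit f x)"
    unfolding bij_betw_def using funpow_cycle_inj[OF f] funpow_card_orbit(2)[OF f, of x]
    by (auto simp: inj_on_def)
  have G: "bij_betw ?G {0..<?n} (orbit g y)"
    unfolding bij_betw_def card using funpow_cycle_inj[OF g] funpow_card_orbit(2)[OF g, of y]
    by (auto simp: inj_on_def)
  define h where "h = ?G \<circ> the_inv_into {0..<?n} ?F"
  have "bij_betw h (orbit f x) (orbit g y)"
    unfolding h_def by (rule bij_betw_trans[OF bij_betw_the_inv_into[OF F] G])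
  moreover have hF: "h (?F i) = ?G i" if "i < ?n" for i
    using the_inv_into_f_f[OF bij_betw_imp_inj_on[OF F], of i] that by (simp add: h_def)
  have n0: "?n > 0"
    using finite_orbit[OF permutation_self_in_orbit[OF f]] permutation_self_in_orbit[OF f]
    by (auto simp: card_gt_0_iff)
  have "h (f z) = g (h z)" if z: "z \<in> orbit f x" for z
  proof -
    obtain i where i: "i < ?n" "z = ?F i"
      using equalityD1[OF funpow_card_orbit(2)[OF f, of x], THEN subsetD, OF z] by auto
    show ?thesis
    proof (cases "Suc i = ?n")
      \<comment> \<open>The wrap-around: \<open>f\<close> and \<open>g\<close> return to
        \<open>x\<close> and \<open>y\<close> after the same number of steps, because the orbits
        have equal size.\<close>
      case True
      have "f z = ?F ?n" using i True by (metis comp_apply funpow.simps(2))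
      then have "f z = ?F 0" using funpow_card_orbit(1)[OF f] by simp
      then have "h (f z) = ?G 0" using hF[OF n0] by simp
      also have "\<dots> = ?G ?n" using funpow_card_orbit(1)[OF g] by (simp add: card)
      also have "\<dots> = g (?G i)" using True by (metis comp_apply funpow.simps(2))
      finally show ?thesis using hF i by simp
    next
      case False
      then have "h (?F (Suc i)) = ?G (Suc i)" using i by (intro hF) simp
      then show ?thesis using hF i by simp
    qed
  qed
  ultimately show ?thesis by blast
qed

lemma bij_betw_cycles:
  assumes f: "f permutes {1..d}" and g: "g permutes {1..d}"
    and eq: "\<And>s. s \<in> {1..d} \<Longrightarrow> cycle_count d s f = cycle_count d s g"
  shows "\<exists>\<phi>. bij_betw \<phi> (orbit f ` {1..d}) (orbit g ` {1..d}) \<and>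
    (\<forall>C\<in>orbit f ` {1..d}. card (\<phi> C) = card C)"
proof -
  let ?P = "\<lambda>f s. {C \<in> orbit f ` {1..d}. card C = s}"
  have range: "card C \<in> {1..d}" if C: "C \<in> orbit h ` {1..d}" and h: "h permutes {1..d}" for C h
  proof -
    obtain x where x: "x \<in> {1..d}" "C = orbit h x" using C by blast
    have sub: "C \<subseteq> {1..d}" using permutes_orbit_subset[OF h] x by blast
    moreover have "x \<in> C"
      using permutation_self_in_orbit h x by (metis finite_atLeastAtMost permutation_permutes)
    moreover have "card C \<le> d" using card_mono[OF _ sub] by simp
    ultimately show ?thesis using finite_subset[OF sub] by (auto simp: card_gt_0_iff Suc_le_eq)
  qed
  have "\<exists>\<phi>. bij_betw \<phi> (?P f s) (?P g s)" for s
  proof (cases "s \<in> {1..d}")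
    case True
    then show ?thesis using eq[OF True] unfolding cycle_count_def
      by (intro finite_same_card_bij) auto
  next
    \<comment> \<open>Every cycle is nonempty and contained in \<open>{1..d}\<close>, so no cycle
      has such a length and the empty bijection works.\<close>
    case False
    have empty: "?P h s = {}" if "h permutes {1..d}" for h
      using range[OF _ that] False by blast
    show ?thesis unfolding empty[OF f] empty[OF g] by (simp add: bij_betw_def)
  qed
  then have "\<forall>s. \<exists>\<phi>. bij_betw \<phi> (?P f s) (?P g s)" by (rule allI)
  from choice[OF this] obtain \<phi> where \<phi>: "bij_betw (\<phi> s) (?P f s) (?P g s)" for s by blast
  \<comment> \<open>The bijections for the separate lengths fit together because each preserves the
    length, which therefore tells which of them was applied.\<close>
  define \<psi> where "\<psi> C = \<phi> (card C) C" for C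
  have mem: "\<psi> C \<in> orbit g ` {1..d} \<and> card (\<psi> C) = card C" if "C \<in> orbit f ` {1..d}" for C
  proof -
    have "\<phi> (card C) C \<in> ?P g (card C)"
      by (rule bij_betw_apply[OF \<phi>]) (use that in blast)
    then show ?thesis by (simp add: \<psi>_def)
  qed
  have "inj_on \<psi> (orbit f ` {1..d})"
  proof (rule inj_onI)
    fix C D assume CD: "C \<in> orbit f ` {1..d}" "D \<in> orbit f ` {1..d}" "\<psi> C = \<psi> D"
    then have "card C = card D" using mem by metis
    then show "C = D"
      using CD inj_onD[OF bij_betw_imp_inj_on[OF \<phi>[of "card C"]], of C D] by (simp add: \<psi>_def)
  qed
  moreover have "\<psi> ` (orbit f ` {1..d}) = orbit g ` {1..d}"
  proof (intro equalityI subsetI)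
    fix D assume D: "D \<in> orbit g ` {1..d}"
    then have "D \<in> \<phi> (card D) ` ?P f (card D)"
      using bij_betw_imp_surj_on[OF \<phi>[of "card D"]] by simp
    then obtain C where "C \<in> ?P f (card D)" "D = \<phi> (card D) C" by blast
    then show "D \<in> \<psi> ` (orbit f ` {1..d})"
      by (intro image_eqI[of _ _ C]) (auto simp: \<psi>_def)
  qed (use mem in blast)
  ultimately show ?thesis using mem unfolding bij_betw_def by blast
qed

text \<open>Pair the cycles of \<open>f\<close> with cycles of \<open>g\<close> of equal length and
  glue the equivariant bijections between paired cycles; the glued map intertwines \<open>f\<close>
  and \<open>g\<close>.\<close>

lemma conjugate_if_cycle_count_eq:
  assumes f: "f permutes {1..d}" and g: "g permutes {1..d}"
    and eq: "\<And>s. s \<in> {1..d} \<Longrightarrow> cycle_count d s f = cycle_count d s g"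
  shows "\<exists>h. h permutes {1..d} \<and> g = h \<circ> f \<circ> inv' h"
proof -
  let ?F = "orbit f ` {1..d}" and ?G = "orbit g ` {1..d}"
  have pf: "permutation f" and pg: "permutation g"
    using f g by (auto simp: permutation_permutes)
  obtain \<phi> where \<phi>: "bij_betw \<phi> ?F ?G" "\<And>C. C \<in> ?F \<Longrightarrow> card (\<phi> C) = card C"
    using bij_betw_cycles[OF assms] by auto
  have "\<exists>h. bij_betw h C (\<phi> C) \<and> (\<forall>z\<in>C. h (f z) = g (h z))" if C: "C \<in> ?F" for C
  proof -
    obtain x y where "C = orbit f x" "\<phi> C = orbit g y"
      using C bij_betwE[OF \<phi>(1)] by blast
    then show ?thesis using orbit_bij_equivariant[OF pf pg, of x y] \<phi>(2)[OF C] by simp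
  qed
  then have "\<forall>C\<in>?F. \<exists>h. bij_betw h C (\<phi> C) \<and> (\<forall>z\<in>C. h (f z) = g (h z))"
    by (rule ballI)
  from bchoice[OF this] obtain h
    where "\<forall>C\<in>?F. bij_betw (h C) C (\<phi> C) \<and> (\<forall>z\<in>C. h C (f z) = g (h C z))" ..
  then have h: "bij_betw (h C) C (\<phi> C)" "z \<in> C \<Longrightarrow> h C (f z) = g (h C z)"
    if "C \<in> ?F" for C z
    using that by (blast, blast)
  have orbit_eq: "orbit p z = C" if "permutation p" "C \<in> orbit p ` {1..d}" "z \<in> C" for p C z
  proof -
    from that(2) obtain x where x: "C = orbit p x" ..
    show ?thesis using orbit_cyclic_eq3[OF cyclic_on_orbit'[OF that(1)], of z x] that(3) by (simp add: x)
  qed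
  \<comment> \<open>Each point uses the bijection chosen for its own cycle; outside
    \<open>{1..d}\<close> the identity is required for \<open>H permutes {1..d}\<close>.\<close>
  define H where "H x = (if x \<in> {1..d} then h (orbit f x) x else x)" for x
  have HC: "H z = h C z" if "C \<in> ?F" "z \<in> C" for C z
  proof -
    from that(1) obtain x where "x \<in> {1..d}" "C = orbit f x" by (rule imageE) simp
    then have "z \<in> {1..d}" using that(2) permutes_orbit_subset[OF f] by blast
    then show ?thesis using orbit_eq[OF pf that] by (simp add: H_def)
  qed
  have un: "(\<Union>C\<in>orbit p ` {1..d}. C) = {1..d}" if "p permutes {1..d}" for p
  proof (intro equalityI subsetI)
    have perm: "permutation p" using that by (auto simp: permutation_permutes)
    fix x assume "x \<in> {1..d}"
    then show "x \<in> (\<Union>C\<in>orbit p ` {1..d}. C)"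
      using permutation_self_in_orbit[OF perm] by (intro UN_I) auto
  qed (use permutes_orbit_subset[OF that] in blast)
  \<comment> \<open>Gluing stays injective because distinct cycles have distinct, hence disjoint,
    partners.\<close>
  have "bij_betw H (\<Union>C\<in>?F. C) (\<Union>C\<in>?F. \<phi> C)"
  proof (rule bij_betw_UNION_disjoint)
    show "disjoint_family_on \<phi> ?F"
      unfolding disjoint_family_on_def
    proof (intro ballI impI)
      fix C D assume CD: "C \<in> ?F" "D \<in> ?F" "C \<noteq> D"
      then have "\<phi> C \<noteq> \<phi> D" using \<phi>(1) by (metis bij_betw_imp_inj_on inj_onD)
      moreover have "\<phi> C \<in> ?G" "\<phi> D \<in> ?G" using CD bij_betwE[OF \<phi>(1)] by auto
      ultimately show "\<phi> C \<inter> \<phi> D = {}" using orbit_eq[OF pg] by (metis disjoint_iff)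
    qed
    show "bij_betw H C (\<phi> C)" if "C \<in> ?F" for C
      using h(1)[OF that] HC[OF that] by (simp cong: bij_betw_cong)
  qed
  moreover have "(\<Union>C\<in>?F. \<phi> C) = {1..d}"
    using un[OF g] bij_betw_imp_surj_on[OF \<phi>(1)] by simp
  ultimately have "bij_betw H {1..d} {1..d}" using un[OF f] by simp
  then have H: "H permutes {1..d}" by (rule bij_imp_permutes) (auto simp: H_def)
  have "H (f x) = g (H x)" for x
  proof (cases "x \<in> {1..d}")
    case True
    have C: "orbit f x \<in> ?F" "x \<in> orbit f x" using True permutation_self_in_orbit[OF pf] by auto
    have "f x \<in> orbit f x" by (rule orbit.base)
    then show ?thesis using HC[OF C(1)] h(2)[OF C] C(2) by metis
  next
    case False
    then show ?thesis using f g H by (metis permutes_not_in)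
  qed
  then have "g = H \<circ> f \<circ> inv' H"
    using permutes_bij[OF H] by (simp add: fun_eq_iff) (metis bij_inv_eq_iff)
  then show ?thesis using H by blast
qed


section \<open>Permutation groups\<close>

lemma sym_group_closed:
  "id \<in> carrier (sym_group d)"
  "g \<in> carrier (sym_group d) \<Longrightarrow> h \<in> carrier (sym_group d) \<Longrightarrow> g \<circ> h \<in> carrier (sym_group d)"
  "g \<in> carrier (sym_group d) \<Longrightarrow> inv' g \<in> carrier (sym_group d)"
  by (simp_all add: sym_group_carrier permutes_id permutes_compose permutes_inv)

lemma sym_group_cancel:
  assumes "g \<in> carrier (sym_group d)"
  shows "g \<circ> inv' g = id" "inv' g \<circ> g = id" "g \<circ> (inv' g \<circ> f) = f" "inv' g \<circ> (g \<circ> f) = f"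
    "inv' (inv' g) = g"
  using assms by (auto simp: sym_group_carrier permutes_inv_o permutes_inv_inv simp flip: comp_assoc)

lemma sym_group_inv_comp:
  assumes "g \<in> carrier (sym_group d)" "h \<in> carrier (sym_group d)"
  shows "inv' (g \<circ> h) = inv' h \<circ> inv' g"
  using assms by (intro o_inv_distrib) (auto simp: sym_group_carrier permutes_bij)

lemma finite_sym_group: "finite (carrier (sym_group d))"
  by (simp add: sym_group_def finite_permutations)

lemma card_sym_group: "card (carrier (sym_group d)) = fact d"
  by (simp add: sym_group_def card_permutations)

lemma sum_sym_group_conjugate:
  assumes "g \<in> carrier (sym_group d)"
  shows "(\<Sum>\<sigma>\<in>carrier (sym_group d). f (inv' g \<circ> \<sigma> \<circ> g)) = (\<Sum>\<sigma>\<in>carrier (sym_group d). f \<sigma>)"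
  using assms
  by (intro sum.reindex_bij_witness[where i = "\<lambda>\<sigma>. g \<circ> \<sigma> \<circ> inv' g" and j = "\<lambda>\<sigma>. inv' g \<circ> \<sigma> \<circ> g"])
     (simp_all add: sym_group_closed comp_assoc sym_group_cancel[of _ d])

section \<open>Subgroups of the symmetric group and left transversals\<close>

locale perm_group =
  fixes d :: nat and W :: "(nat \<Rightarrow> nat) set"
  assumes subgroup: "subgroup W (sym_group d)"
begin

lemma in_sym: "w \<in> W \<Longrightarrow> w \<in> carrier (sym_group d)"
  using subgroup by (rule subgroup.mem_carrier)

lemma id_in: "id \<in> W"
  using subgroup.one_closed[OF subgroup] by (simp add: sym_group_one)

lemma comp_in: "v \<in> W \<Longrightarrow> w \<in> W \<Longrightarrow> v \<circ> w \<in> W"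
  using subgroup.m_closed[OF subgroup] by (simp add: sym_group_mult)

lemma inv_in: "w \<in> W \<Longrightarrow> inv' w \<in> W"
  using subgroup.m_inv_closed[OF subgroup] in_sym by (metis sym_group_inv_equality)

lemma finite: "finite W"
  using finite_subset[OF _ finite_sym_group] in_sym by blast

lemma card_pos: "card W > 0"
  using finite id_in by (auto simp: card_gt_0_iff)

lemma comp_in_cancel_right:
  assumes "w \<in> W" "x \<in> carrier (sym_group d)"
  shows "x \<circ> w \<in> W \<longleftrightarrow> x \<in> W"
proof
  assume "x \<circ> w \<in> W"
  then have "(x \<circ> w) \<circ> inv' w \<in> W" by (rule comp_in[OF _ inv_in[OF assms(1)]])
  then show "x \<in> W" using in_sym[OF assms(1)] by (simp add: comp_assoc sym_group_cancel[of _ d])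
qed (use assms comp_in in blast)

lemma comp_in_cancel_left:
  assumes "w \<in> W" "x \<in> carrier (sym_group d)"
  shows "w \<circ> x \<in> W \<longleftrightarrow> x \<in> W"
proof
  assume "w \<circ> x \<in> W"
  then have "inv' w \<circ> (w \<circ> x) \<in> W" by (rule comp_in[OF inv_in[OF assms(1)]])
  then show "x \<in> W" using in_sym[OF assms(1)] by (simp add: sym_group_cancel[of _ d])
qed (use assms comp_in in blast)

text \<open>The condition \<open>inv' t \<circ> g \<in> W\<close> says that \<open>g\<close> lies in
  the left coset tW. A representative is chosen by \<open>SOME\<close> from a predicate describing
  the coset alone, so equal cosets receive equal representatives.\<close>

lemma ex_transversal:
  obtains T where "T \<subseteq> carrier (sym_group d)"
    "\<And>g. g \<in> carrier (sym_group d) \<Longrightarrow> \<exists>!t. t \<in> T \<and> inv' t \<circ> g \<in> W"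
proof -
  let ?G = "carrier (sym_group d)"
  define r where "r g = (SOME t. t \<in> ?G \<and> inv' g \<circ> t \<in> W)" for g
  have r: "r g \<in> ?G" "inv' g \<circ> r g \<in> W" if "g \<in> ?G" for g
  proof -
    have "r g \<in> ?G \<and> inv' g \<circ> r g \<in> W"
      unfolding r_def by (rule someI[of _ g]) (simp only: sym_group_cancel(2)[OF that] id_in that simp_thms)
    then show "r g \<in> ?G" "inv' g \<circ> r g \<in> W" by auto
  qed
  have r_cong: "r g = r h" if "g \<in> ?G" "h \<in> ?G" "inv' g \<circ> h \<in> W" for g h
  proof -
    \<comment> \<open>The first factor on the right lies in W, so it can be cancelled in a
      membership test for W.\<close>
    have eq: "inv' g \<circ> t = (inv' g \<circ> h) \<circ> (inv' h \<circ> t)" for t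
      using that by (simp add: comp_assoc sym_group_cancel[of _ d])
    have "inv' g \<circ> t \<in> W \<longleftrightarrow> inv' h \<circ> t \<in> W" if "t \<in> ?G" for t
      unfolding eq[of t] using that \<open>h \<in> ?G\<close>
      by (intro comp_in_cancel_left \<open>inv' g \<circ> h \<in> W\<close>) (simp add: sym_group_closed)
    then have "(\<lambda>t. t \<in> ?G \<and> inv' g \<circ> t \<in> W) = (\<lambda>t. t \<in> ?G \<and> inv' h \<circ> t \<in> W)" by auto
    then show ?thesis by (simp add: r_def)
  qed
  show thesis
  proof (rule that[of "r ` ?G"])
    show "r ` ?G \<subseteq> ?G" using r by auto
    fix g assume g: "g \<in> ?G"
    show "\<exists>!t. t \<in> r ` ?G \<and> inv' t \<circ> g \<in> W"
    proof (rule ex1I[of _ "r g"])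
      have "inv' (inv' g \<circ> r g) \<in> W" using r g by (intro inv_in)
      then show "r g \<in> r ` ?G \<and> inv' (r g) \<circ> g \<in> W"
        using g r by (simp add: sym_group_inv_comp[of _ d] sym_group_closed sym_group_cancel[of _ d])
    next
      fix t assume t: "t \<in> r ` ?G \<and> inv' t \<circ> g \<in> W"
      then obtain h where h: "h \<in> ?G" "t = r h" by blast
      have "(inv' h \<circ> r h) \<circ> (inv' (r h) \<circ> g) \<in> W" using t h r by (intro comp_in[OF r(2)[OF h(1)]]) auto
      then have "inv' h \<circ> g \<in> W" using r h by (simp add: comp_assoc sym_group_cancel[of _ d])
      then show "t = r g" using r_cong h g by simp
    qed
  qed
qed

end


section \<open>Generalised characters\<close>

text \<open>Representations arise below with bases indexed by coset representatives or by pairs. An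
  arbitrary finite index set spares them a numbering, which is done here once.\<close>

lemma sym_charsI:
  fixes \<rho> :: "(nat \<Rightarrow> nat) \<Rightarrow> 'x \<Rightarrow> 'x \<Rightarrow> 'a::field"
  assumes fin: "finite X"
    and one: "\<And>x y. x \<in> X \<Longrightarrow> y \<in> X \<Longrightarrow> \<rho> id x y = (if x = y then 1 else 0)"
    and mult: "\<And>\<sigma> \<tau> x z. \<sigma> \<in> carrier (sym_group d) \<Longrightarrow> \<tau> \<in> carrier (sym_group d) \<Longrightarrow> x \<in> X \<Longrightarrow> z \<in> X \<Longrightarrow>
      \<rho> (\<sigma> \<circ> \<tau>) x z = (\<Sum>y\<in>X. \<rho> \<sigma> x y * \<rho> \<tau> y z)"
  shows "(\<lambda>\<sigma>\<in>carrier (sym_group d). \<Sum>x\<in>X. \<rho> \<sigma> x x) \<in> sym_chars d"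
proof -
  define n where "n = card X"
  obtain b where b: "bij_betw b {0..<n} X"
    using ex_bij_betw_nat_finite[OF fin] n_def by blast
  have bX: "b i \<in> X" if "i < n" for i using b that by (auto simp: bij_betw_def)
  have b_inj: "b i = b j \<longleftrightarrow> i = j" if "i < n" "j < n" for i j
    using b that by (auto simp: bij_betw_def inj_on_def)
  define M where "M \<sigma> = mat n n (\<lambda>(i, j). \<rho> \<sigma> (b i) (b j))" for \<sigma>
  have M_carrier: "M \<sigma> \<in> carrier_mat n n" for \<sigma> by (simp add: M_def)
  have M_one: "M id = 1\<^sub>m n"
    by (rule eq_matI) (auto simp: M_def one bX b_inj)
  have M_mult: "M (\<sigma> \<circ> \<tau>) = M \<sigma> * M \<tau>"
    if "\<sigma> \<in> carrier (sym_group d)" "\<tau> \<in> carrier (sym_group d)" for \<sigma> \<tau>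
  proof (rule eq_matI)
    fix i j assume ij: "i < dim_row (M \<sigma> * M \<tau>)" "j < dim_col (M \<sigma> * M \<tau>)"
    then have "i < n" "j < n" by (simp_all add: M_def)
    then have "M (\<sigma> \<circ> \<tau>) $$ (i, j) = (\<Sum>y\<in>X. \<rho> \<sigma> (b i) y * \<rho> \<tau> y (b j))"
      using mult[OF that] bX by (simp add: M_def)
    also have "\<dots> = (\<Sum>k\<in>{0..<n}. \<rho> \<sigma> (b i) (b k) * \<rho> \<tau> (b k) (b j))"
      by (rule sum.reindex_bij_betw[OF b, symmetric])
    also have "\<dots> = (M \<sigma> * M \<tau>) $$ (i, j)"
      using \<open>i < n\<close> \<open>j < n\<close> by (simp add: M_def scalar_prod_def)
    finally show "M (\<sigma> \<circ> \<tau>) $$ (i, j) = (M \<sigma> * M \<tau>) $$ (i, j)" .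
  qed (simp_all add: M_def)
  \<comment> \<open>Multiplicativity together with \<open>M_one\<close> makes the matrix of
    \<open>inv' \<sigma>\<close> a two-sided inverse.\<close>
  have "M \<sigma> \<in> Units (ring_mat TYPE('a) n ())" if s: "\<sigma> \<in> carrier (sym_group d)" for \<sigma>
    unfolding Units_def ring_mat_simps mem_Collect_eq
    using M_mult[OF s sym_group_closed(3)[OF s]] M_mult[OF sym_group_closed(3)[OF s] s] M_carrier
    by (intro conjI bexI[of _ "M (inv' \<sigma>)"]) (simp_all add: sym_group_cancel[OF s] M_one)
  then have "M \<in> hom (sym_group d) (units_of (ring_mat TYPE('a) n ()))"
    by (intro homI) (simp_all add: units_of_carrier units_of_mult ring_mat_simps sym_group_mult M_mult)
  moreover have "(\<lambda>\<sigma>\<in>carrier (sym_group d). \<Sum>x\<in>X. \<rho> \<sigma> x x) =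
      (\<lambda>\<sigma>\<in>carrier (sym_group d). \<Sum>i<n. M \<sigma> $$ (i, i))"
    by (rule restrict_ext)
       (simp add: M_def lessThan_atLeast0 flip: sum.reindex_bij_betw[OF b])
  ultimately show ?thesis unfolding sym_chars_def by blast
qed

lemma sym_charsE:
  assumes "u \<in> sym_chars d"
  obtains n :: nat and \<rho> :: "(nat \<Rightarrow> nat) \<Rightarrow> nat \<Rightarrow> nat \<Rightarrow> 'a::field"
  where "u = (\<lambda>\<sigma>\<in>carrier (sym_group d). \<Sum>x<n. \<rho> \<sigma> x x)"
    and "\<And>x y. x < n \<Longrightarrow> y < n \<Longrightarrow> \<rho> id x y = (if x = y then 1 else 0)"
    and "\<And>\<sigma> \<tau> x z. \<sigma> \<in> carrier (sym_group d) \<Longrightarrow> \<tau> \<in> carrier (sym_group d) \<Longrightarrow> x < n \<Longrightarrow> z < n \<Longrightarrow>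
      \<rho> (\<sigma> \<circ> \<tau>) x z = (\<Sum>y<n. \<rho> \<sigma> x y * \<rho> \<tau> y z)"
proof -
  obtain n M where u: "u = (\<lambda>\<sigma>\<in>carrier (sym_group d). \<Sum>x<n. M \<sigma> $$ (x, x))"
    and M: "M \<in> hom (sym_group d) (units_of (ring_mat TYPE('a) n ()))"
    using assms unfolding sym_chars_def by blast
  interpret R: ring "ring_mat TYPE('a) n ()" by (rule ring_mat)
  interpret H: group_hom "sym_group d" "units_of (ring_mat TYPE('a) n ())" M
    using M R.units_group sym_group_is_group by (simp add: group_hom_def group_hom_axioms_def)
  have one: "M id = 1\<^sub>m n"
    using H.hom_one by (simp add: sym_group_one units_of_one ring_mat_simps)
  have carr: "M \<sigma> \<in> carrier_mat n n" if "\<sigma> \<in> carrier (sym_group d)" for \<sigma>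
    using H.hom_closed[OF that] R.Units_closed by (simp add: units_of_carrier ring_mat_simps)
  show thesis
  proof (rule that[of "\<lambda>\<sigma> x y. M \<sigma> $$ (x, y)" n])
    fix \<sigma> \<tau> x z
    assume st: "\<sigma> \<in> carrier (sym_group d)" "\<tau> \<in> carrier (sym_group d)" "x < n" "z < n"
    then have "M (\<sigma> \<circ> \<tau>) = M \<sigma> * M \<tau>"
      using H.hom_mult by (simp add: sym_group_mult units_of_mult ring_mat_simps)
    then show "M (\<sigma> \<circ> \<tau>) $$ (x, z) = (\<Sum>y<n. M \<sigma> $$ (x, y) * M \<tau> $$ (y, z))"
      using st carr[of \<sigma>] carr[of \<tau>] by (simp add: scalar_prod_def lessThan_atLeast0)
  qed (use u one in simp_all)
qed

text \<open>The traces of AB and BA agree, used with the matrices of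
  \<open>g \<circ> \<sigma>\<close> and \<open>inv' g\<close>.\<close>

lemma sym_chars_conjugate:
  assumes u: "u \<in> sym_chars d" and g: "g \<in> carrier (sym_group d)" and s: "\<sigma> \<in> carrier (sym_group d)"
  shows "u (g \<circ> \<sigma> \<circ> inv' g) = u \<sigma>"
proof -
  obtain n :: nat and \<rho> where u: "u = (\<lambda>\<sigma>\<in>carrier (sym_group d). \<Sum>x<n. \<rho> \<sigma> x x)"
    and "\<And>x y. x < n \<Longrightarrow> y < n \<Longrightarrow> \<rho> id x y = (if x = y then 1 else 0)"
    and mult: "\<And>\<sigma> \<tau> x z. \<sigma> \<in> carrier (sym_group d) \<Longrightarrow> \<tau> \<in> carrier (sym_group d) \<Longrightarrow> x < n \<Longrightarrow> z < n \<Longrightarrow>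
      \<rho> (\<sigma> \<circ> \<tau>) x z = (\<Sum>y<n. \<rho> \<sigma> x y * \<rho> \<tau> y z)"
    using u by (rule sym_charsE) (rule that)
  have G: "g \<circ> \<sigma> \<in> carrier (sym_group d)" "inv' g \<in> carrier (sym_group d)"
    "g \<circ> \<sigma> \<circ> inv' g \<in> carrier (sym_group d)"
    using g s by (auto intro!: sym_group_closed)
  have "u (g \<circ> \<sigma> \<circ> inv' g) = (\<Sum>x<n. \<Sum>y<n. \<rho> (g \<circ> \<sigma>) x y * \<rho> (inv' g) y x)"
    using G mult[OF G(1,2)] by (simp add: u)
  also have "\<dots> = (\<Sum>y<n. \<Sum>x<n. \<rho> (inv' g) y x * \<rho> (g \<circ> \<sigma>) x y)"
    by (subst sum.swap) (simp add: mult.commute)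
  also have "\<dots> = (\<Sum>y<n. \<rho> (inv' g \<circ> (g \<circ> \<sigma>)) y y)"
    by (intro sum.cong refl mult[OF G(2,1), symmetric]) auto
  also have "\<dots> = u \<sigma>" using g s by (simp add: u sym_group_cancel[of _ d])
  finally show ?thesis .
qed

text \<open>The Kronecker product of the two representations, indexed by pairs, has the product of
  the traces as its trace.\<close>

lemma sym_chars_mult:
  assumes "u \<in> sym_chars d" "v \<in> sym_chars d"
  shows "(\<lambda>\<sigma>\<in>carrier (sym_group d). u \<sigma> * v \<sigma> :: 'a::field) \<in> sym_chars d"
proof -
  obtain n :: nat and \<rho> :: "_ \<Rightarrow> _ \<Rightarrow> _ \<Rightarrow> 'a" where u: "u = (\<lambda>\<sigma>\<in>carrier (sym_group d). \<Sum>x<n. \<rho> \<sigma> x x)"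
    and \<rho>: "\<And>x y. x < n \<Longrightarrow> y < n \<Longrightarrow> \<rho> id x y = (if x = y then 1 else 0)"
      "\<And>\<sigma> \<tau> x z. \<sigma> \<in> carrier (sym_group d) \<Longrightarrow> \<tau> \<in> carrier (sym_group d) \<Longrightarrow> x < n \<Longrightarrow> z < n \<Longrightarrow>
      \<rho> (\<sigma> \<circ> \<tau>) x z = (\<Sum>y<n. \<rho> \<sigma> x y * \<rho> \<tau> y z)"
    using assms(1) by (rule sym_charsE) (rule that)
  obtain n' :: nat and \<rho>' :: "_ \<Rightarrow> _ \<Rightarrow> _ \<Rightarrow> 'a" where v: "v = (\<lambda>\<sigma>\<in>carrier (sym_group d). \<Sum>x<n'. \<rho>' \<sigma> x x)"
    and \<rho>': "\<And>x y. x < n' \<Longrightarrow> y < n' \<Longrightarrow> \<rho>' id x y = (if x = y then 1 else 0)"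
      "\<And>\<sigma> \<tau> x z. \<sigma> \<in> carrier (sym_group d) \<Longrightarrow> \<tau> \<in> carrier (sym_group d) \<Longrightarrow> x < n' \<Longrightarrow> z < n' \<Longrightarrow>
      \<rho>' (\<sigma> \<circ> \<tau>) x z = (\<Sum>y<n'. \<rho>' \<sigma> x y * \<rho>' \<tau> y z)"
    using assms(2) by (rule sym_charsE) (rule that)
  define P where "P = (\<lambda>\<sigma> x y. \<rho> \<sigma> (fst x) (fst y) * \<rho>' \<sigma> (snd x) (snd y))"
  have "(\<lambda>\<sigma>\<in>carrier (sym_group d). \<Sum>x\<in>{..<n} \<times> {..<n'}. P \<sigma> x x) \<in> sym_chars d"
  proof (rule sym_charsI[where \<rho> = P])
    fix \<sigma> \<tau> x z
    assume st: "\<sigma> \<in> carrier (sym_group d)" "\<tau> \<in> carrier (sym_group d)"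
      and xz: "x \<in> {..<n} \<times> {..<n'}" "z \<in> {..<n} \<times> {..<n'}"
    then have "P (\<sigma> \<circ> \<tau>) x z = (\<Sum>i<n. \<rho> \<sigma> (fst x) i * \<rho> \<tau> i (fst z)) * (\<Sum>j<n'. \<rho>' \<sigma> (snd x) j * \<rho>' \<tau> j (snd z))"
      using \<rho>(2)[OF st] \<rho>'(2)[OF st] by (auto simp: P_def)
    also have "\<dots> = (\<Sum>y\<in>{..<n} \<times> {..<n'}. P \<sigma> x y * P \<tau> y z)"
      unfolding sum_product sum.cartesian_product by (auto simp: P_def intro!: sum.cong)
    finally show "P (\<sigma> \<circ> \<tau>) x z = (\<Sum>y\<in>{..<n} \<times> {..<n'}. P \<sigma> x y * P \<tau> y z)" .
  qed (auto simp: P_def \<rho> \<rho>' split: if_splits)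
  also have "(\<lambda>\<sigma>\<in>carrier (sym_group d). \<Sum>x\<in>{..<n} \<times> {..<n'}. P \<sigma> x x) = (\<lambda>\<sigma>\<in>carrier (sym_group d). u \<sigma> * v \<sigma>)"
    by (rule restrict_ext) (auto simp: u v P_def sum_product sum.cartesian_product intro!: sum.cong)
  finally show ?thesis .
qed

lemma sym_chars_subset_gen_chars: "sym_chars d \<subseteq> (gen_chars d :: ((nat \<Rightarrow> nat) \<Rightarrow> 'a::field) set)"
proof
  fix u :: "(nat \<Rightarrow> nat) \<Rightarrow> 'a" assume u: "u \<in> sym_chars d"
  \<comment> \<open>The representation of dimension zero affords the zero character, which is
    subtracted from \<open>u\<close>.\<close>
  have "(\<lambda>\<sigma>\<in>carrier (sym_group d). \<Sum>x\<in>({}::nat set). (0::'a)) \<in> sym_chars d"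
    by (rule sym_charsI) auto
  moreover have "u = (\<lambda>\<sigma>\<in>carrier (sym_group d). u \<sigma> - (\<lambda>\<sigma>\<in>carrier (sym_group d). \<Sum>x\<in>({}::nat set). (0::'a)) \<sigma>)"
    using u by (auto simp: sym_chars_def fun_eq_iff)
  ultimately show "u \<in> gen_chars d" using u unfolding gen_chars_def by blast
qed

lemma gen_chars_conjugate:
  assumes "u \<in> gen_chars d" "g \<in> carrier (sym_group d)" "\<sigma> \<in> carrier (sym_group d)"
  shows "u (g \<circ> \<sigma> \<circ> inv' g) = u \<sigma>"
proof -
  have "g \<circ> \<sigma> \<circ> inv' g \<in> carrier (sym_group d)"
    using assms by (auto intro!: sym_group_closed)
  then show ?thesis using assms by (auto simp: gen_chars_def sym_chars_conjugate)
qed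


section \<open>Induced characters\<close>

text \<open>Frobenius' formula, averaged over the whole symmetric group instead of summed over coset
  representatives. In this form a product of induced characters expands directly over placements,
  with no choice of representatives.\<close>

definition ind_char :: "nat \<Rightarrow> (nat \<Rightarrow> nat) set \<Rightarrow> ((nat \<Rightarrow> nat) \<Rightarrow> 'a::field) \<Rightarrow> (nat \<Rightarrow> nat) \<Rightarrow> 'a" where
  "ind_char d W \<chi> = (\<lambda>\<sigma>\<in>carrier (sym_group d).
     (\<Sum>g\<in>carrier (sym_group d). if inv' g \<circ> \<sigma> \<circ> g \<in> W then \<chi> (inv' g \<circ> \<sigma> \<circ> g) else 0) / of_nat (card W))"

lemma linear_char_mult:
  "linear_char d W \<chi> \<Longrightarrow> v \<in> W \<Longrightarrow> w \<in> W \<Longrightarrow> \<chi> (v \<circ> w) = \<chi> v * \<chi> w"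
  by (simp add: linear_char_def hom_def subgrp_def units_group_def sym_group_mult)

lemma linear_char_nonzero: "linear_char d W \<chi> \<Longrightarrow> w \<in> W \<Longrightarrow> \<chi> w \<noteq> 0"
  by (auto simp: linear_char_def hom_def subgrp_def units_group_def)

context perm_group
begin

lemma linear_char_id:
  assumes "linear_char d W \<chi>"
  shows "\<chi> id = 1"
  using linear_char_mult[OF assms id_in id_in] linear_char_nonzero[OF assms id_in] by simp

lemma linear_char_inv:
  assumes "linear_char d W \<chi>" "w \<in> W"
  shows "\<chi> (inv' w) * \<chi> w = 1"
  using linear_char_mult[OF assms(1) inv_in[OF assms(2)] assms(2)] in_sym[OF assms(2)]
    linear_char_id[OF assms(1)] by (simp add: sym_group_cancel[of _ d])

lemma linear_char_one: "linear_char d W (\<lambda>_. 1)"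
  by (simp add: linear_char_def hom_def subgrp_def units_group_def)

lemma conj_in_iff:
  assumes w: "w \<in> W" and s: "\<sigma> \<in> carrier (sym_group d)"
  shows "inv' w \<circ> \<sigma> \<circ> w \<in> W \<longleftrightarrow> \<sigma> \<in> W"
  using comp_in_cancel_right[OF w, of "inv' w \<circ> \<sigma>"] comp_in_cancel_left[OF inv_in[OF w] s]
    sym_group_closed(2)[OF in_sym[OF inv_in[OF w]] s] by simp

text \<open>Every g is tw for exactly one representative t and one w in W. The extension
  \<open>f\<close> of the character by zero is invariant under conjugation by W, so each t is
  counted \<open>card W\<close> times.\<close>

lemma ind_char_eq_sum_transversal:
  fixes \<chi> :: "(nat \<Rightarrow> nat) \<Rightarrow> 'a::field_char_0"
  assumes \<chi>: "linear_char d W \<chi>" and T: "T \<subseteq> carrier (sym_group d)"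
    "\<And>g. g \<in> carrier (sym_group d) \<Longrightarrow> \<exists>!t. t \<in> T \<and> inv' t \<circ> g \<in> W"
    and s: "\<sigma> \<in> carrier (sym_group d)"
  shows "ind_char d W \<chi> \<sigma> = (\<Sum>t\<in>T. if inv' t \<circ> \<sigma> \<circ> t \<in> W then \<chi> (inv' t \<circ> \<sigma> \<circ> t) else 0)"
proof -
  let ?G = "carrier (sym_group d)"
  define f where "f x = (if x \<in> W then \<chi> x else 0)" for x
  have f_conj: "f (inv' w \<circ> x \<circ> w) = f x" if "w \<in> W" "x \<in> ?G" for w x
    using linear_char_mult[OF \<chi>] linear_char_inv[OF \<chi> that(1)] that inv_in comp_in
    by (simp add: f_def conj_in_iff mult.assoc mult.left_commute)
  have "bij_betw (\<lambda>(t, w). t \<circ> w) (T \<times> W) ?G"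
    unfolding bij_betw_def
  proof
    show "inj_on (\<lambda>(t, w). t \<circ> w) (T \<times> W)"
    proof (rule inj_onI, clarify)
      fix t w t' w' assume *: "t \<in> T" "w \<in> W" "t' \<in> T" "w' \<in> W" "t \<circ> w = t' \<circ> w'"
      have tG: "t \<in> ?G" "t' \<in> ?G" using * T by auto
      have "t \<circ> w \<in> ?G" using tG * in_sym by (intro sym_group_closed)
      moreover have "inv' t \<circ> (t \<circ> w) \<in> W" by (simp only: sym_group_cancel(4)[OF tG(1)] *(2))
      moreover have "inv' t' \<circ> (t \<circ> w) \<in> W" by (simp only: *(5) sym_group_cancel(4)[OF tG(2)] *(4))
      ultimately have "t = t'" using T(2)[of "t \<circ> w"] *(1,3) by blast
      moreover then have "w = w'" using * tG sym_group_cancel(4)[OF tG(1)] by metis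
      ultimately show "t = t' \<and> w = w'" by simp
    qed
    show "(\<lambda>(t, w). t \<circ> w) ` (T \<times> W) = ?G"
    proof (intro equalityI subsetI)
      fix g assume g: "g \<in> ?G"
      then obtain t where t: "t \<in> T" "inv' t \<circ> g \<in> W" using T(2) by blast
      have eq: "t \<circ> (inv' t \<circ> g) = g" using t T by (simp add: sym_group_cancel[of _ d] subset_iff)
      show "g \<in> (\<lambda>(t, w). t \<circ> w) ` (T \<times> W)"
        by (rule image_eqI[of _ _ "(t, inv' t \<circ> g)"]) (simp_all add: t eq)
    qed (use T in_sym in \<open>auto intro!: sym_group_closed\<close>)
  qed
  then have "(\<Sum>g\<in>?G. f (inv' g \<circ> \<sigma> \<circ> g)) = (\<Sum>(t, w)\<in>T \<times> W. f (inv' (t \<circ> w) \<circ> \<sigma> \<circ> (t \<circ> w)))"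
    by (subst sum.reindex_bij_betw[symmetric]) (auto simp: case_prod_unfold)
  also have "\<dots> = (\<Sum>(t, w)\<in>T \<times> W. f (inv' t \<circ> \<sigma> \<circ> t))"
  proof (intro sum.cong refl, clarify)
    fix t w assume tw: "t \<in> T" "w \<in> W"
    then have G: "t \<in> ?G" "w \<in> ?G" using T in_sym by auto
    have "inv' (t \<circ> w) \<circ> \<sigma> \<circ> (t \<circ> w) = inv' w \<circ> (inv' t \<circ> \<sigma> \<circ> t) \<circ> w"
      by (simp add: sym_group_inv_comp[OF G] comp_assoc)
    then show "f (inv' (t \<circ> w) \<circ> \<sigma> \<circ> (t \<circ> w)) = f (inv' t \<circ> \<sigma> \<circ> t)"
      using f_conj[OF tw(2), of "inv' t \<circ> \<sigma> \<circ> t"] G s by (simp add: sym_group_closed)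
  qed
  also have "\<dots> = of_nat (card W) * (\<Sum>t\<in>T. f (inv' t \<circ> \<sigma> \<circ> t))"
    by (simp add: sum.cartesian_product[symmetric] sum_distrib_left)
  finally show ?thesis using s card_pos by (simp add: ind_char_def f_def)
qed

text \<open>The matrices of the induced representation: the entry at (x, y) is the character,
  extended by zero, at \<open>inv' x \<circ> \<sigma> \<circ> y\<close>. They are monomial, since
  for given y only the representative of the coset of \<open>\<sigma> \<circ> y\<close> gives a
  nonzero entry.\<close>

lemma ind_char_in_sym_chars:
  fixes \<chi> :: "(nat \<Rightarrow> nat) \<Rightarrow> 'a::field_char_0"
  assumes \<chi>: "linear_char d W \<chi>"
  shows "ind_char d W \<chi> \<in> sym_chars d"
proof -
  let ?G = "carrier (sym_group d)"
  obtain T where T: "T \<subseteq> ?G" "\<And>g. g \<in> ?G \<Longrightarrow> \<exists>!t. t \<in> T \<and> inv' t \<circ> g \<in> W"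
    using ex_transversal by blast
  define f where "f x = (if x \<in> W then \<chi> x else 0)" for x
  have "(\<lambda>\<sigma>\<in>?G. \<Sum>t\<in>T. f (inv' t \<circ> \<sigma> \<circ> t)) \<in> sym_chars d"
  proof (rule sym_charsI[where \<rho> = "\<lambda>\<sigma> x y. f (inv' x \<circ> \<sigma> \<circ> y)"])
    show fin: "finite T" using T(1) finite_sym_group by (rule finite_subset)
    fix x y assume xy: "x \<in> T" "y \<in> T"
    then have G: "x \<in> ?G" "y \<in> ?G" using T by auto
    have "inv' y \<circ> y \<in> W" using id_in by (simp add: sym_group_cancel[OF G(2)])
    then have "inv' x \<circ> y \<in> W \<longleftrightarrow> x = y" using T(2)[OF G(2)] xy by metis
    then show "f (inv' x \<circ> id \<circ> y) = (if x = y then 1 else 0)"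
      using linear_char_id[OF \<chi>] by (auto simp: f_def sym_group_cancel[OF G(2)])
  next
    fix \<sigma> \<tau> x z assume st: "\<sigma> \<in> ?G" "\<tau> \<in> ?G" and xz: "x \<in> T" "z \<in> T"
    have G: "x \<in> ?G" "z \<in> ?G" using xz T by auto
    have "\<tau> \<circ> z \<in> ?G" using st G by (intro sym_group_closed)
    \<comment> \<open>Only the representative \<open>y\<close> of the coset of
      \<open>\<tau> \<circ> z\<close> contributes to the matrix product.\<close>
    then obtain y where y: "y \<in> T" "inv' y \<circ> (\<tau> \<circ> z) \<in> W"
      and uniq: "\<And>t. t \<in> T \<Longrightarrow> inv' t \<circ> (\<tau> \<circ> z) \<in> W \<Longrightarrow> t = y"
      using T(2) by metis
    have yG: "y \<in> ?G" using y T by auto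
    have "(\<Sum>t\<in>T. f (inv' x \<circ> \<sigma> \<circ> t) * f (inv' t \<circ> \<tau> \<circ> z))
        = (\<Sum>t\<in>{y}. f (inv' x \<circ> \<sigma> \<circ> t) * f (inv' t \<circ> \<tau> \<circ> z))"
    proof (rule sum.mono_neutral_right)
      show "\<forall>t\<in>T - {y}. f (inv' x \<circ> \<sigma> \<circ> t) * f (inv' t \<circ> \<tau> \<circ> z) = 0"
      proof
        fix t assume "t \<in> T - {y}"
        then have "inv' t \<circ> \<tau> \<circ> z \<notin> W" using uniq[of t] by (auto simp only: comp_assoc)
        then show "f (inv' x \<circ> \<sigma> \<circ> t) * f (inv' t \<circ> \<tau> \<circ> z) = 0" by (simp add: f_def)
      qed
    qed (use y finite_subset[OF T(1) finite_sym_group] in auto)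
    \<comment> \<open>The right factor lies in W, so the left factor and the composite lie in W
      together; when they do not, both sides are zero.\<close>
    also have "\<dots> = f ((inv' x \<circ> \<sigma> \<circ> y) \<circ> (inv' y \<circ> \<tau> \<circ> z))"
    proof -
      have "inv' x \<circ> \<sigma> \<circ> y \<in> ?G" using G st yG by (intro sym_group_closed)
      moreover have "inv' y \<circ> \<tau> \<circ> z \<in> W" using y by (simp only: comp_assoc)
      ultimately show ?thesis
        using comp_in_cancel_right[of "inv' y \<circ> \<tau> \<circ> z" "inv' x \<circ> \<sigma> \<circ> y"]
          linear_char_mult[OF \<chi>, of "inv' x \<circ> \<sigma> \<circ> y" "inv' y \<circ> \<tau> \<circ> z"]
        by (simp add: f_def del: comp_apply)
    qed
    also have "(inv' x \<circ> \<sigma> \<circ> y) \<circ> (inv' y \<circ> \<tau> \<circ> z) = inv' x \<circ> (\<sigma> \<circ> \<tau>) \<circ> z"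
      by (simp add: comp_assoc sym_group_cancel[OF yG])
    finally show "f (inv' x \<circ> (\<sigma> \<circ> \<tau>) \<circ> z) = (\<Sum>t\<in>T. f (inv' x \<circ> \<sigma> \<circ> t) * f (inv' t \<circ> \<tau> \<circ> z))" ..
  qed
  also have "(\<lambda>\<sigma>\<in>?G. \<Sum>t\<in>T. f (inv' t \<circ> \<sigma> \<circ> t)) = ind_char d W \<chi>"
  proof (rule extensionalityI[where A = ?G])
    show "ind_char d W \<chi> \<in> extensional ?G" by (simp add: ind_char_def)
    show "(\<lambda>\<sigma>\<in>?G. \<Sum>t\<in>T. f (inv' t \<circ> \<sigma> \<circ> t)) \<sigma> = ind_char d W \<chi> \<sigma>" if "\<sigma> \<in> ?G" for \<sigma>
      using ind_char_eq_sum_transversal[OF \<chi> T that] that by (simp add: f_def)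
  qed simp
  finally show ?thesis .
qed

end


section \<open>The characteristic map\<close>

definition cycle_type :: "nat \<Rightarrow> (nat \<Rightarrow> nat) \<Rightarrow> (nat \<Rightarrow>\<^sub>0 nat)" where
  "cycle_type d \<sigma> = (\<Sum>s=1..d. Poly_Mapping.single s (cycle_count d s \<sigma>))"

lemma lookup_cycle_type:
  "Poly_Mapping.lookup (cycle_type d \<sigma>) s = (if s \<in> {1..d} then cycle_count d s \<sigma> else 0)"
  by (simp add: cycle_type_def lookup_sum lookup_single when_def)

lemma keys_cycle_type: "Poly_Mapping.keys (cycle_type d \<sigma>) \<subseteq> {1..d}"
  by (auto simp: in_keys_iff lookup_cycle_type split: if_splits)

lemma psum_monom_cycle_type:
  "psum_monom (cycle_type d \<sigma>) = (\<Prod>s=1..d. psum s ^ cycle_count d s \<sigma>)"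
proof -
  have "psum_monom (cycle_type d \<sigma>) = (\<Prod>s=1..d. psum s ^ Poly_Mapping.lookup (cycle_type d \<sigma>) s)"
    unfolding psum_monom_def using keys_cycle_type[of d \<sigma>]
    by (intro prod.mono_neutral_left) (auto simp: in_keys_iff)
  then show ?thesis by (simp add: lookup_cycle_type)
qed

lemma cycle_type_conjugate:
  assumes "g \<in> carrier (sym_group d)" "\<sigma> \<in> carrier (sym_group d)"
  shows "cycle_type d (g \<circ> \<sigma> \<circ> inv' g) = cycle_type d \<sigma>"
  using assms by (simp add: cycle_type_def cycle_count_conjugate sym_group_carrier sym_group_carrier'[of \<sigma>])

lemma cycle_type_eq_imp_conjugate:
  assumes "\<sigma> \<in> carrier (sym_group d)" "\<tau> \<in> carrier (sym_group d)" "cycle_type d \<sigma> = cycle_type d \<tau>"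
  shows "\<exists>g\<in>carrier (sym_group d). \<tau> = g \<circ> \<sigma> \<circ> inv' g"
proof -
  have "cycle_count d s \<sigma> = cycle_count d s \<tau>" if "s \<in> {1..d}" for s
    using arg_cong[OF assms(3), of "\<lambda>e. Poly_Mapping.lookup e s"] that by (simp add: lookup_cycle_type)
  then show ?thesis
    using conjugate_if_cycle_count_eq[of \<sigma> d \<tau>] assms by (auto simp: sym_group_carrier)
qed

text \<open>The explicit polynomial that the description in \<open>psum_poly\<close> must return for
  \<open>ch d u\<close>.\<close>

definition ch_poly :: "nat \<Rightarrow> ((nat \<Rightarrow> nat) \<Rightarrow> 'a::field_char_0) \<Rightarrow> ((nat \<Rightarrow>\<^sub>0 nat) \<Rightarrow>\<^sub>0 'a)" where
  "ch_poly d u = (\<Sum>\<sigma>\<in>carrier (sym_group d). Poly_Mapping.single (cycle_type d \<sigma>) (u \<sigma> / fact d))"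

lemma psum_subst_ch_poly: "psum_subst (ch_poly d u) = ch d u"
proof -
  have "mconst (u \<sigma> / fact d) = mconst (1 / fact d) * mconst (u \<sigma>)" for \<sigma>
    by (simp flip: mconst_mult)
  then show ?thesis
    by (simp add: ch_poly_def ch_def psum_subst_sum psum_subst_single psum_monom_cycle_type
        sum_distrib_left mult.assoc)
qed

lemma psum_poly_ch: "psum_poly d (ch d u) = ch_poly d u"
proof -
  have "Poly_Mapping.keys (ch_poly d u) \<subseteq> cycle_type d ` carrier (sym_group d)"
    unfolding ch_poly_def
    by (rule order_trans[OF Poly_Mapping.keys_sum]) (auto split: if_splits)
  then have "\<forall>e\<in>Poly_Mapping.keys (ch_poly d u). Poly_Mapping.keys e \<subseteq> {1..d}"
    using keys_cycle_type by blast
  then show ?thesis using psum_poly_psum_subst[of "ch_poly d u" d] by (simp add: psum_subst_ch_poly)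
qed

text \<open>Each permutation contributes a single monomial, so the coefficient sum is the mean of
  \<open>u\<close> over the group, that is, its scalar product with the trivial character.\<close>

lemma coeff_sum_psum_poly_ch:
  "coeff_sum (psum_poly d (ch d u)) = (\<Sum>\<sigma>\<in>carrier (sym_group d). u \<sigma>) / fact d"
  by (simp add: psum_poly_ch ch_poly_def coeff_sum_sum coeff_sum_single sum_divide_distrib)

text \<open>Permutations of one cycle type form one conjugacy class, on which a generalised
  character is constant. The coefficient at a cycle type is therefore the class size times that
  value over d!, and the value can be recovered.\<close>

lemma inj_on_ch: "inj_on (ch d) (gen_chars d :: ((nat \<Rightarrow> nat) \<Rightarrow> 'a::field_char_0) set)"
proof (rule inj_onI)
  fix u v :: "(nat \<Rightarrow> nat) \<Rightarrow> 'a"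
  assume uv: "u \<in> gen_chars d" "v \<in> gen_chars d" "ch d u = ch d v"
  let ?G = "carrier (sym_group d)"
  have eq: "ch_poly d u = ch_poly d v" using uv(3) by (metis psum_poly_ch)
  have coeff: "Poly_Mapping.lookup (ch_poly d w) (cycle_type d \<tau>)
      = of_nat (card {\<sigma> \<in> ?G. cycle_type d \<sigma> = cycle_type d \<tau>}) * (w \<tau> / fact d)"
    if w: "w \<in> gen_chars d" and \<tau>: "\<tau> \<in> ?G" for w :: "(nat \<Rightarrow> nat) \<Rightarrow> 'a" and \<tau>
  proof -
    have "w \<sigma> = w \<tau>" if "\<sigma> \<in> ?G" "cycle_type d \<sigma> = cycle_type d \<tau>" for \<sigma>
      using cycle_type_eq_imp_conjugate[OF that(1) \<tau> that(2)] gen_chars_conjugate[OF w _ that(1)] by auto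
    then have "(\<Sum>\<sigma>\<in>?G. (w \<sigma> / fact d when cycle_type d \<sigma> = cycle_type d \<tau>))
        = (\<Sum>\<sigma>\<in>?G. if cycle_type d \<sigma> = cycle_type d \<tau> then w \<tau> / fact d else 0)"
      by (intro sum.cong) (auto simp: when_def)
    also have "\<dots> = (\<Sum>\<sigma>\<in>{\<sigma> \<in> ?G. cycle_type d \<sigma> = cycle_type d \<tau>}. w \<tau> / fact d)"
      by (rule sum.inter_filter[OF finite_sym_group, symmetric])
    finally show ?thesis by (simp add: ch_poly_def lookup_sum lookup_single)
  qed
  show "u = v"
  proof (rule extensionalityI[where A = ?G])
    fix \<tau> assume \<tau>: "\<tau> \<in> ?G"
    have "card {\<sigma> \<in> ?G. cycle_type d \<sigma> = cycle_type d \<tau>} > 0"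
      using \<tau> finite_sym_group[of d] by (auto simp: card_gt_0_iff)
    then show "u \<tau> = v \<tau>" using coeff[OF uv(1) \<tau>] coeff[OF uv(2) \<tau>] by (simp add: eq)
  qed (use uv in \<open>auto simp: gen_chars_def\<close>)
qed

text \<open>Injectivity on \<open>gen_chars d\<close> lets \<open>inv_into\<close> return exactly
  \<open>u\<close> and \<open>v\<close>. Genuine characters suffice here, and they are closed under
  products, so the rule can be iterated.\<close>

lemma internal_prod_ch:
  assumes "u \<in> sym_chars d" "v \<in> sym_chars d"
  shows "internal_prod d (ch d u) (ch d v) = ch d (\<lambda>\<sigma>\<in>carrier (sym_group d). u \<sigma> * v \<sigma>)"
  by (simp add: internal_prod_def assms[THEN subsetD[OF sym_chars_subset_gen_chars], THEN inv_into_f_f[OF inj_on_ch]])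

lemma foldl_internal_prod_ch:
  assumes "u \<in> sym_chars d" "\<And>m. m \<in> set ms \<Longrightarrow> v m \<in> sym_chars d"
  shows "foldl (internal_prod d) (ch d u) (map (\<lambda>m. ch d (v m)) ms) =
    ch d (\<lambda>\<sigma>\<in>carrier (sym_group d). u \<sigma> * prod_list (map (\<lambda>m. v m \<sigma>) ms))"
  using assms
proof (induction ms arbitrary: u)
  case Nil
  \<comment> \<open>\<open>ch\<close> evaluates its argument only on the symmetric group, so the
    restriction is invisible to it.\<close>
  then show ?case by (simp add: ch_def)
next
  case (Cons m ms)
  have "foldl (internal_prod d) (ch d u) (map (\<lambda>m. ch d (v m)) (m # ms)) =
      foldl (internal_prod d) (ch d (\<lambda>\<sigma>\<in>carrier (sym_group d). u \<sigma> * v m \<sigma>)) (map (\<lambda>m. ch d (v m)) ms)"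
    using Cons.prems by (simp add: internal_prod_ch)
  also have "\<dots> = ch d (\<lambda>\<sigma>\<in>carrier (sym_group d).
      (\<lambda>\<sigma>\<in>carrier (sym_group d). u \<sigma> * v m \<sigma>) \<sigma> * prod_list (map (\<lambda>m. v m \<sigma>) ms))"
    using Cons.prems by (intro Cons.IH sym_chars_mult) auto
  also have "(\<lambda>\<sigma>\<in>carrier (sym_group d).
      (\<lambda>\<sigma>\<in>carrier (sym_group d). u \<sigma> * v m \<sigma>) \<sigma> * prod_list (map (\<lambda>m. v m \<sigma>) ms)) =
      (\<lambda>\<sigma>\<in>carrier (sym_group d). u \<sigma> * prod_list (map (\<lambda>m. v m \<sigma>) (m # ms)))"
    by (rule restrict_ext) (simp add: mult.assoc)
  finally show ?case .
qed

lemma (in perm_group) cycle_index_eq_ch_ind_char: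
  fixes \<chi> :: "(nat \<Rightarrow> nat) \<Rightarrow> 'a::field_char_0"
  shows "cycle_index d W \<chi> = ch d (ind_char d W \<chi>)"
proof -
  let ?G = "carrier (sym_group d)"
  let ?M = "\<lambda>\<sigma>. psum_monom (cycle_type d \<sigma>) :: 'a mseries"
  define f where "f x = (if x \<in> W then \<chi> x else 0)" for x
  have "(\<Sum>\<sigma>\<in>?G. mconst (ind_char d W \<chi> \<sigma>) * ?M \<sigma>)
      = mconst (1 / of_nat (card W)) * (\<Sum>\<sigma>\<in>?G. \<Sum>g\<in>?G. mconst (f (inv' g \<circ> \<sigma> \<circ> g)) * ?M \<sigma>)"
    unfolding sum_distrib_left
  proof (rule sum.cong[OF refl])
    fix \<sigma> assume s: "\<sigma> \<in> ?G"
    have "ind_char d W \<chi> \<sigma> = 1 / of_nat (card W) * (\<Sum>g\<in>?G. f (inv' g \<circ> \<sigma> \<circ> g))"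
      using s by (simp add: ind_char_def f_def)
    then show "mconst (ind_char d W \<chi> \<sigma>) * ?M \<sigma> =
        (\<Sum>g\<in>?G. mconst (1 / of_nat (card W)) * (mconst (f (inv' g \<circ> \<sigma> \<circ> g)) * ?M \<sigma>))"
      by (simp only: mconst_mult mconst_sum sum_distrib_left sum_distrib_right mult.assoc)
  qed
  also have "(\<Sum>\<sigma>\<in>?G. \<Sum>g\<in>?G. mconst (f (inv' g \<circ> \<sigma> \<circ> g)) * ?M \<sigma>)
      = (\<Sum>g\<in>?G. \<Sum>\<sigma>\<in>?G. mconst (f (inv' g \<circ> \<sigma> \<circ> g)) * ?M \<sigma>)"
    by (rule sum.swap)
  \<comment> \<open>The monomial depends only on the cycle type, so it may be conjugated along with
    the argument of \<open>f\<close>. Reindexing then removes g and leaves d! equal sums.\<close>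
  also have "\<dots> = (\<Sum>g\<in>?G. \<Sum>\<sigma>\<in>?G. mconst (f (inv' g \<circ> \<sigma> \<circ> g)) * ?M (inv' g \<circ> \<sigma> \<circ> g))"
  proof (intro sum.cong refl)
    fix g \<sigma> assume *: "g \<in> ?G" "\<sigma> \<in> ?G"
    have "cycle_type d (inv' g \<circ> \<sigma> \<circ> g) = cycle_type d \<sigma>"
      using cycle_type_conjugate[OF sym_group_closed(3)[OF *(1)] *(2)] * by (simp add: sym_group_cancel[of _ d])
    then show "mconst (f (inv' g \<circ> \<sigma> \<circ> g)) * ?M \<sigma> = mconst (f (inv' g \<circ> \<sigma> \<circ> g)) * ?M (inv' g \<circ> \<sigma> \<circ> g)"
      by simp
  qed
  also have "\<dots> = (\<Sum>g\<in>?G. \<Sum>\<sigma>\<in>?G. mconst (f \<sigma>) * ?M \<sigma>)"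
    by (rule sum.cong[OF refl]) (rule sum_sym_group_conjugate[of _ d "\<lambda>\<sigma>. mconst (f \<sigma>) * ?M \<sigma>"])
  also have "\<dots> = mconst (fact d) * (\<Sum>\<sigma>\<in>?G. mconst (f \<sigma>) * ?M \<sigma>)"
  proof -
    \<comment> \<open>The number of summands appears as an integer of the series ring; as a constant
      series it can cancel against \<open>1 / fact d\<close>.\<close>
    have "of_nat n = (mconst (of_nat n) :: 'a mseries)" for n
      by (induction n) (simp_all add: mconst_add, simp add: mconst_def one_mseries_def)
    from this[of "fact d"] show ?thesis by (simp add: card_sym_group)
  qed
  also have "(\<Sum>\<sigma>\<in>?G. mconst (f \<sigma>) * ?M \<sigma>) = (\<Sum>\<sigma>\<in>W. mconst (\<chi> \<sigma>) * ?M \<sigma>)"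
    using in_sym finite_sym_group
    by (intro sum.mono_neutral_cong_right) (auto simp: f_def)
  finally have "ch d (ind_char d W \<chi>) = mconst (1 / fact d) * (mconst (1 / of_nat (card W)) *
      (mconst (fact d) * (\<Sum>\<sigma>\<in>W. mconst (\<chi> \<sigma>) * ?M \<sigma>)))"
    by (simp add: ch_def psum_monom_cycle_type)
  also have "\<dots> = mconst (1 / fact d * (1 / of_nat (card W)) * fact d) * (\<Sum>\<sigma>\<in>W. mconst (\<chi> \<sigma>) * ?M \<sigma>)"
    by (simp only: mconst_mult mult.assoc)
  also have "\<dots> = cycle_index d W \<chi>"
    by (simp add: cycle_index_def psum_monom_cycle_type)
  finally show ?thesis ..
qed


section \<open>Counting superpositions\<close>

text \<open>If |H| divides |N|, the image in G/N of an element of H has order dividing both |N| and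
  |G/N|, hence is trivial by coprimality. The converse is Lagrange's theorem.\<close>

lemma (in group) card_dvd_iff_subset_normal:
  assumes "N \<lhd> G" and fin: "finite (carrier G)" and H: "subgroup H G"
    and cop: "coprime (order (G Mod N)) (card N)"
  shows "card H dvd card N \<longleftrightarrow> H \<subseteq> N"
proof
  interpret N: normal N G by fact
  interpret H: subgroup H G by fact
  interpret Q: group "G Mod N" by (rule N.factorgroup_is_group)
  interpret q: group_hom G "G Mod N" "\<lambda>x. N #> x"
    using N.r_coset_hom_Mod by unfold_locales
  assume dvd: "card H dvd card N"
  show "H \<subseteq> N"
  proof
    fix h assume h: "h \<in> H"
    then have hG: "h \<in> carrier G" by simp
    interpret HG: group "G\<lparr>carrier := H\<rparr>" by (rule H.subgroup_is_group[OF group_axioms])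
    have "h [^] order (G\<lparr>carrier := H\<rparr>) = \<one>"
      using HG.pow_order_eq_1[of h] h by (simp flip: nat_pow_consistent)
    then have "(N #> h) [^]\<^bsub>G Mod N\<^esub> card H = \<one>\<^bsub>G Mod N\<^esub>"
      using q.hom_nat_pow[OF hG, of "card H"] q.hom_one by (simp add: order_def)
    then have "Q.ord (N #> h) dvd card H"
      using Q.pow_eq_id[OF q.hom_closed[OF hG]] by blast
    then have "Q.ord (N #> h) dvd card N" using dvd by (rule dvd_trans)
    moreover have "Q.ord (N #> h) dvd order (G Mod N)"
      by (rule Q.ord_dvd_group_order[OF q.hom_closed[OF hG]])
    ultimately have "Q.ord (N #> h) = 1" using cop by (meson coprime_common_divisor_nat)
    then have "N #> h = N" using Q.ord_eq_1[OF q.hom_closed[OF hG]] by simp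
    then show "h \<in> N" using hG by (rule coset_join1) (rule N.subgroup_axioms)
  qed
next
  assume "H \<subseteq> N"
  then have "subgroup H (G\<lparr>carrier := N\<rparr>)"
    by (intro subgroup_incl H normal_imp_subgroup \<open>N \<lhd> G\<close>)
  then have "card H dvd order (G\<lparr>carrier := N\<rparr>)"
    using group.lagrange[OF subgroup.subgroup_is_group[OF normal_imp_subgroup[OF \<open>N \<lhd> G\<close>] group_axioms]]
    by (metis dvd_triv_right)
  then show "card H dvd card N" by (simp add: order_def)
qed

section \<open>Automorphism groups of graphs and sums of linear characters\<close>

lemma perm_groupI:
  assumes "W \<subseteq> carrier (sym_group d)" "id \<in> W" "\<And>v w. v \<in> W \<Longrightarrow> w \<in> W \<Longrightarrow> v \<circ> w \<in> W"
    "\<And>w. w \<in> W \<Longrightarrow> inv' w \<in> W"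
  shows "perm_group d W"
proof (rule perm_group.intro)
  interpret G: group "sym_group d" by (rule sym_group_is_group)
  show "subgroup W (sym_group d)"
    using assms by (intro G.subgroupI) (auto simp: sym_group_mult subset_iff)
qed

lemma perm_group_graph_aut: "perm_group d (graph_aut d E)"
proof (rule perm_groupI)
  show "graph_aut d E \<subseteq> carrier (sym_group d)" by (auto simp: graph_aut_def)
  show "id \<in> graph_aut d E" by (simp add: graph_aut_def sym_group_closed)
  fix v w assume vw: "v \<in> graph_aut d E" "w \<in> graph_aut d E"
  have "w i \<in> {1..d}" if "i \<in> {1..d}" for i
    using vw that permutes_in_image[of w "{1..d}" i] unfolding graph_aut_def sym_group_carrier by blast
  then show "v \<circ> w \<in> graph_aut d E"
    using vw by (auto simp: graph_aut_def sym_group_closed)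
next
  fix w assume w: "w \<in> graph_aut d E"
  then have perm: "w permutes {1..d}" by (simp add: graph_aut_def sym_group_carrier)
  have "count E (Upair (inv' w i) (inv' w j)) = count E (Upair i j)" if "i \<in> {1..d}" "j \<in> {1..d}" for i j
  proof -
    have "inv' w i \<in> {1..d}" "inv' w j \<in> {1..d}"
      using that permutes_in_image[OF permutes_inv[OF perm]] by auto
    then have "count E (Upair (w (inv' w i)) (w (inv' w j))) = count E (Upair (inv' w i) (inv' w j))"
      using w unfolding graph_aut_def by blast
    then show ?thesis by (simp add: permutes_inverses[OF perm])
  qed
  then show "inv' w \<in> graph_aut d E"
    using w by (auto simp: graph_aut_def sym_group_closed)
qed

text \<open>Translation by an element v with nontrivial value permutes the terms but multiplies the
  sum by \<open>\<chi> v\<close>, so the sum must vanish.\<close>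

lemma (in perm_group) sum_linear_char:
  fixes \<chi> :: "(nat \<Rightarrow> nat) \<Rightarrow> 'a::field"
  assumes \<chi>: "linear_char d W \<chi>"
  shows "(\<Sum>w\<in>W. \<chi> w) = (if \<forall>w\<in>W. \<chi> w = 1 then of_nat (card W) else 0)"
proof (cases "\<forall>w\<in>W. \<chi> w = 1")
  case False
  then obtain v where v: "v \<in> W" "\<chi> v \<noteq> 1" by blast
  have "(\<Sum>w\<in>W. \<chi> (v \<circ> w)) = (\<Sum>w\<in>W. \<chi> w)"
    by (rule sum.reindex_bij_witness[where i = "\<lambda>w. inv' v \<circ> w" and j = "\<lambda>w. v \<circ> w"])
       (simp_all add: v comp_in inv_in sym_group_cancel[OF in_sym[OF v(1)]])
  moreover have "(\<Sum>w\<in>W. \<chi> (v \<circ> w)) = \<chi> v * (\<Sum>w\<in>W. \<chi> w)"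
    using linear_char_mult[OF \<chi> v(1)] by (simp add: sum_distrib_left)
  ultimately have "(\<chi> v - 1) * (\<Sum>w\<in>W. \<chi> w) = 0" by (simp add: left_diff_distrib)
  then have "(\<Sum>w\<in>W. \<chi> w) = 0" using v(2) by simp
  then show ?thesis using False by (simp only: if_False)
qed simp

section \<open>Placements, superpositions and their automorphism groups\<close>

locale perm_groups =
  fixes d k :: nat and W :: "nat \<Rightarrow> (nat \<Rightarrow> nat) set"
  assumes k_pos: "k \<ge> 1" and groups: "m \<in> {1..k} \<Longrightarrow> perm_group d (W m)"
begin

abbreviation "placements \<equiv> {1..k} \<rightarrow>\<^sub>E carrier (sym_group d)"

lemma placement_in_sym: "a \<in> placements \<Longrightarrow> m \<in> {1..k} \<Longrightarrow> a m \<in> carrier (sym_group d)"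
  by blast

lemma mem_sup_aut:
  assumes "a \<in> placements"
  shows "\<sigma> \<in> sup_aut k W a \<longleftrightarrow> (\<forall>m\<in>{1..k}. inv' (a m) \<circ> \<sigma> \<circ> a m \<in> W m)"
proof -
  have "\<sigma> \<in> (\<lambda>w. a m \<circ> w \<circ> inv' (a m)) ` W m \<longleftrightarrow> inv' (a m) \<circ> \<sigma> \<circ> a m \<in> W m" if "m \<in> {1..k}" for m
  proof
    note c = sym_group_cancel[OF placement_in_sym[OF assms that]]
    assume "inv' (a m) \<circ> \<sigma> \<circ> a m \<in> W m"
    then show "\<sigma> \<in> (\<lambda>w. a m \<circ> w \<circ> inv' (a m)) ` W m"
      by (rule image_eqI[rotated]) (simp add: comp_assoc c)
  next
    note c = sym_group_cancel[OF placement_in_sym[OF assms that]]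
    assume "\<sigma> \<in> (\<lambda>w. a m \<circ> w \<circ> inv' (a m)) ` W m"
    then show "inv' (a m) \<circ> \<sigma> \<circ> a m \<in> W m" by (auto simp: comp_assoc c simp del: comp_apply)
  qed
  then show ?thesis by (simp add: sup_aut_def)
qed

lemma sup_aut_conj_in:
  "a \<in> placements \<Longrightarrow> \<sigma> \<in> sup_aut k W a \<Longrightarrow> m \<in> {1..k} \<Longrightarrow> inv' (a m) \<circ> \<sigma> \<circ> a m \<in> W m"
  using mem_sup_aut by blast

lemma conj_comp:
  assumes "a \<in> placements" "m \<in> {1..k}"
  shows "inv' (a m) \<circ> (\<sigma> \<circ> \<tau>) \<circ> a m = (inv' (a m) \<circ> \<sigma> \<circ> a m) \<circ> (inv' (a m) \<circ> \<tau> \<circ> a m)"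
  by (simp add: comp_assoc sym_group_cancel[OF placement_in_sym[OF assms]])

lemma conj_inv:
  assumes "a \<in> placements" "m \<in> {1..k}" "\<sigma> \<in> carrier (sym_group d)"
  shows "inv' (a m) \<circ> inv' \<sigma> \<circ> a m = inv' (inv' (a m) \<circ> \<sigma> \<circ> a m)"
  using placement_in_sym[OF assms(1,2)] assms(3)
  by (simp add: sym_group_inv_comp[of _ d] sym_group_closed sym_group_cancel[of _ d] comp_assoc)

lemma perm_group_sup_aut:
  assumes a: "a \<in> placements"
  shows "perm_group d (sup_aut k W a)"
proof (rule perm_groupI)
  show sub: "sup_aut k W a \<subseteq> carrier (sym_group d)"
  proof
    fix \<sigma> assume "\<sigma> \<in> sup_aut k W a"
    \<comment> \<open>An intersection over no index would contain all functions; the first conjugate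
      is what confines \<open>\<sigma>\<close> to the symmetric group.\<close>
    moreover have 1: "1 \<in> {1..k}" using k_pos by simp
    ultimately obtain w where "w \<in> W 1" "\<sigma> = a 1 \<circ> w \<circ> inv' (a 1)"
      unfolding sup_aut_def by blast
    then show "\<sigma> \<in> carrier (sym_group d)"
      using perm_group.in_sym[OF groups[OF 1]] placement_in_sym[OF a 1] by (simp add: sym_group_closed)
  qed
  show "id \<in> sup_aut k W a"
    unfolding mem_sup_aut[OF a]
    using perm_group.id_in[OF groups] sym_group_cancel(2)[OF placement_in_sym[OF a]]
    by (simp del: atLeastAtMost_iff)
  fix \<sigma> assume s: "\<sigma> \<in> sup_aut k W a"
  show "inv' \<sigma> \<in> sup_aut k W a"
    unfolding mem_sup_aut[OF a]
  proof
    fix m assume m: "m \<in> {1..k}"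
    show "inv' (a m) \<circ> inv' \<sigma> \<circ> a m \<in> W m"
      unfolding conj_inv[OF a m subsetD[OF sub s]]
      by (rule perm_group.inv_in[OF groups[OF m] sup_aut_conj_in[OF a s m]])
  qed
  fix \<tau> assume t: "\<tau> \<in> sup_aut k W a"
  show "\<sigma> \<circ> \<tau> \<in> sup_aut k W a"
    unfolding mem_sup_aut[OF a]
  proof
    fix m assume m: "m \<in> {1..k}"
    show "inv' (a m) \<circ> (\<sigma> \<circ> \<tau>) \<circ> a m \<in> W m"
      unfolding conj_comp[OF a m]
      by (intro perm_group.comp_in[OF groups[OF m]] sup_aut_conj_in[OF a _ m] s t)
  qed
qed

text \<open>The map whose image is the class of \<open>a\<close>. Its parameters \<open>w\<close>
  are taken from \<open>Pi\<^sub>E {1..k} W\<close>, so that they form a finite set of the expected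
  size and irrelevant values at other indices do not inflate the fibres.\<close>

definition place :: "(nat \<Rightarrow> nat \<Rightarrow> nat) \<Rightarrow> (nat \<Rightarrow> nat) \<times> (nat \<Rightarrow> nat \<Rightarrow> nat) \<Rightarrow> nat \<Rightarrow> nat \<Rightarrow> nat" where
  "place a = (\<lambda>(\<zeta>, w). \<lambda>m\<in>{1..k}. \<zeta> \<circ> a m \<circ> w m)"

lemma place_in:
  assumes "a \<in> placements" "\<zeta> \<in> carrier (sym_group d)" "w \<in> Pi\<^sub>E {1..k} W"
  shows "place a (\<zeta>, w) \<in> placements"
  unfolding place_def prod.case
proof (rule restrict_PiE_iff[THEN iffD2], rule ballI)
  fix m assume m: "m \<in> {1..k}"
  have "w m \<in> W m" using assms(3) m by blast
  then have "w m \<in> carrier (sym_group d)" by (rule perm_group.in_sym[OF groups[OF m]])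
  then show "\<zeta> \<circ> a m \<circ> w m \<in> carrier (sym_group d)"
    using assms placement_in_sym[OF _ m] by (intro sym_group_closed)
qed

lemma sup_rel_iff:
  "(a, b) \<in> sup_rel d k W \<longleftrightarrow> a \<in> placements \<and> b \<in> place a ` (carrier (sym_group d) \<times> Pi\<^sub>E {1..k} W)"
proof
  assume ab: "(a, b) \<in> sup_rel d k W"
  then obtain \<zeta> w where *: "a \<in> placements" "b \<in> placements" "\<zeta> \<in> carrier (sym_group d)"
    "\<And>m. m \<in> {1..k} \<Longrightarrow> w m \<in> W m \<and> b m = \<zeta> \<circ> a m \<circ> w m"
    unfolding sup_rel_def by blast
  have "b = place a (\<zeta>, restrict w {1..k})"
    unfolding place_def prod.case
    by (rule extensionalityI[where A = "{1..k}"]) (use * in \<open>auto simp: PiE_def simp del: atLeastAtMost_iff\<close>)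
  then show "a \<in> placements \<and> b \<in> place a ` (carrier (sym_group d) \<times> Pi\<^sub>E {1..k} W)"
    using * by (auto intro!: image_eqI simp del: atLeastAtMost_iff)
next
  assume "a \<in> placements \<and> b \<in> place a ` (carrier (sym_group d) \<times> Pi\<^sub>E {1..k} W)"
  then obtain \<zeta> w where *: "a \<in> placements" "b = place a (\<zeta>, w)" "\<zeta> \<in> carrier (sym_group d)"
    "w \<in> Pi\<^sub>E {1..k} W" by blast
  have "\<forall>m\<in>{1..k}. w m \<in> W m \<and> b m = \<zeta> \<circ> a m \<circ> w m"
  proof
    fix m assume m: "m \<in> {1..k}"
    then show "w m \<in> W m \<and> b m = \<zeta> \<circ> a m \<circ> w m"
      using *(4) by (simp add: *(2) place_def PiE_mem del: atLeastAtMost_iff)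
  qed
  moreover have "b \<in> placements" using place_in[OF *(1,3,4)] *(2) by simp
  ultimately show "(a, b) \<in> sup_rel d k W" unfolding sup_rel_def using *(1,3) by blast
qed

lemma equiv_sup_rel: "equiv placements (sup_rel d k W)"
proof (rule equivI)
  show "sup_rel d k W \<subseteq> placements \<times> placements" by (auto simp: sup_rel_def)
  show "refl_on placements (sup_rel d k W)"
  proof (rule refl_onI)
    fix a assume a: "a \<in> placements"
    have "\<forall>m\<in>{1..k}. id \<in> W m \<and> a m = id \<circ> a m \<circ> id"
      using perm_group.id_in[OF groups] by simp
    then show "(a, a) \<in> sup_rel d k W"
      unfolding sup_rel_def using a sym_group_closed(1)
      by (intro CollectI case_prodI conjI bexI[of _ id] exI[of _ "\<lambda>_. id"]) auto
  qed
  show "sym (sup_rel d k W)"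
  proof (rule symI)
    fix a b assume "(a, b) \<in> sup_rel d k W"
    then obtain \<zeta> w where *: "a \<in> placements" "b \<in> placements" "\<zeta> \<in> carrier (sym_group d)"
      "\<And>m. m \<in> {1..k} \<Longrightarrow> w m \<in> W m \<and> b m = \<zeta> \<circ> a m \<circ> w m"
      unfolding sup_rel_def by blast
    have "inv' (w m) \<in> W m \<and> a m = inv' \<zeta> \<circ> b m \<circ> inv' (w m)" if m: "m \<in> {1..k}" for m
    proof -
      have w: "w m \<in> W m" using *(4)[OF m] by simp
      note c = sym_group_cancel[OF perm_group.in_sym[OF groups[OF m] w]] sym_group_cancel[OF *(3)]
      have "inv' \<zeta> \<circ> b m \<circ> inv' (w m) = a m"
        using *(4)[OF m] by (simp add: comp_assoc c)
      then show ?thesis using perm_group.inv_in[OF groups[OF m] w] by simp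
    qed
    then show "(b, a) \<in> sup_rel d k W"
      unfolding sup_rel_def using * sym_group_closed(3)[OF *(3)]
      by (intro CollectI case_prodI conjI bexI[of _ "inv' \<zeta>"] exI[of _ "\<lambda>m. inv' (w m)"]) auto
  qed
  show "trans (sup_rel d k W)"
  proof (rule transI)
    fix a b c assume ab: "(a, b) \<in> sup_rel d k W" and bc: "(b, c) \<in> sup_rel d k W"
    from ab obtain \<zeta> w where 1: "a \<in> placements" "\<zeta> \<in> carrier (sym_group d)"
      "\<And>m. m \<in> {1..k} \<Longrightarrow> w m \<in> W m \<and> b m = \<zeta> \<circ> a m \<circ> w m"
      unfolding sup_rel_def by blast
    from bc obtain \<zeta>' w' where 2: "c \<in> placements" "\<zeta>' \<in> carrier (sym_group d)"
      "\<And>m. m \<in> {1..k} \<Longrightarrow> w' m \<in> W m \<and> c m = \<zeta>' \<circ> b m \<circ> w' m"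
      unfolding sup_rel_def by blast
    have "w m \<circ> w' m \<in> W m \<and> c m = (\<zeta>' \<circ> \<zeta>) \<circ> a m \<circ> (w m \<circ> w' m)" if m: "m \<in> {1..k}" for m
      using 1(3)[OF m] 2(3)[OF m] perm_group.comp_in[OF groups[OF m]] by (simp add: comp_assoc)
    then show "(a, c) \<in> sup_rel d k W"
      unfolding sup_rel_def using 1 2 sym_group_closed(2)[OF 2(2) 1(2)]
      by (intro CollectI case_prodI conjI bexI[of _ "\<zeta>' \<circ> \<zeta>"] exI[of _ "\<lambda>m. w m \<circ> w' m"]) auto
  qed
qed

text \<open>Every fibre is a translate of the stabilizer: two parameters with the same placement
  differ by an automorphism of the superposition in the first component, and this determines the
  second.\<close>

lemma card_fibre_place:
  assumes a: "a \<in> placements" and z: "\<zeta>' \<in> carrier (sym_group d)" and w: "w' \<in> Pi\<^sub>E {1..k} W"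
  shows "card {p \<in> carrier (sym_group d) \<times> Pi\<^sub>E {1..k} W. place a p = place a (\<zeta>', w')} = card (sup_aut k W a)"
proof -
  let ?G = "carrier (sym_group d)"
  let ?F = "{p \<in> ?G \<times> Pi\<^sub>E {1..k} W. place a p = place a (\<zeta>', w')}"
  interpret A: perm_group d "sup_aut k W a" by (rule perm_group_sup_aut[OF a])
  \<comment> \<open>The second component solves \<open>\<zeta>' \<circ> \<eta> \<circ> a m \<circ> v
    = \<zeta>' \<circ> a m \<circ> w' m\<close> for v.\<close>
  define to where "to \<eta> = (\<zeta>' \<circ> \<eta>, \<lambda>m\<in>{1..k}. inv' (a m) \<circ> inv' \<eta> \<circ> a m \<circ> w' m)" for \<eta>
  have w': "w' m \<in> W m" "w' m \<in> ?G" if "m \<in> {1..k}" for m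
    using PiE_mem[OF w that] perm_group.in_sym[OF groups[OF that]] by blast+
  have "bij_betw to (sup_aut k W a) ?F"
  proof (rule bij_betw_byWitness[where f' = "\<lambda>p. inv' \<zeta>' \<circ> fst p"])
    show "\<forall>\<eta>\<in>sup_aut k W a. inv' \<zeta>' \<circ> fst (to \<eta>) = \<eta>"
      by (simp add: to_def sym_group_cancel[OF z])
    show "to ` sup_aut k W a \<subseteq> ?F"
    proof (rule image_subsetI)
      fix \<eta> assume e: "\<eta> \<in> sup_aut k W a"
      have "inv' (a m) \<circ> inv' \<eta> \<circ> a m \<circ> w' m \<in> W m" if m: "m \<in> {1..k}" for m
        by (rule perm_group.comp_in[OF groups[OF m] sup_aut_conj_in[OF a A.inv_in[OF e] m] w'(1)[OF m]])
      moreover have "(\<zeta>' \<circ> \<eta>) \<circ> a m \<circ> (inv' (a m) \<circ> inv' \<eta> \<circ> a m \<circ> w' m) = \<zeta>' \<circ> a m \<circ> w' m"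
        if m: "m \<in> {1..k}" for m
        by (simp add: comp_assoc sym_group_cancel[OF placement_in_sym[OF a m]] sym_group_cancel[OF A.in_sym[OF e]])
      ultimately show "to \<eta> \<in> ?F"
        using sym_group_closed(2)[OF z A.in_sym[OF e]]
        by (auto simp: to_def place_def simp del: atLeastAtMost_iff comp_apply intro!: restrict_ext)
    qed
    \<comment> \<open>Equality of the placements turns the conjugate of
      \<open>inv' \<zeta>' \<circ> \<zeta>\<close> into a quotient of two elements of
      \<open>W m\<close>, which puts it in \<open>W m\<close>.\<close>
    have key: "inv' (a m) \<circ> (inv' \<zeta>' \<circ> \<zeta>) \<circ> a m = w' m \<circ> inv' (v m)"
      if "\<zeta> \<in> ?G" "v \<in> Pi\<^sub>E {1..k} W" "place a (\<zeta>, v) = place a (\<zeta>', w')" and m: "m \<in> {1..k}" for \<zeta> v m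
    proof -
      have v: "v m \<in> ?G" using that(2) perm_group.in_sym[OF groups[OF m]] m by blast
      have eq: "\<zeta> \<circ> a m \<circ> v m = \<zeta>' \<circ> a m \<circ> w' m"
        using fun_cong[OF that(3), of m] m by (simp add: place_def del: atLeastAtMost_iff)
      have "inv' (a m) \<circ> (inv' \<zeta>' \<circ> \<zeta>) \<circ> a m = inv' (a m) \<circ> inv' \<zeta>' \<circ> (\<zeta> \<circ> a m \<circ> v m) \<circ> inv' (v m)"
        by (simp add: comp_assoc sym_group_cancel[OF v])
      also have "\<dots> = w' m \<circ> inv' (v m)"
        unfolding eq by (simp add: comp_assoc sym_group_cancel[OF z] sym_group_cancel[OF placement_in_sym[OF a m]])
      finally show ?thesis .
    qed
    have v_in: "v m \<in> W m" if "v \<in> Pi\<^sub>E {1..k} W" "m \<in> {1..k}" for v m using that by blast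
    show "(\<lambda>p. inv' \<zeta>' \<circ> fst p) ` ?F \<subseteq> sup_aut k W a"
    proof (rule image_subsetI)
      fix p assume p: "p \<in> ?F"
      then obtain \<zeta> v where zv: "p = (\<zeta>, v)" "\<zeta> \<in> ?G" "v \<in> Pi\<^sub>E {1..k} W"
        "place a (\<zeta>, v) = place a (\<zeta>', w')" by blast
      show "inv' \<zeta>' \<circ> fst p \<in> sup_aut k W a"
        unfolding mem_sup_aut[OF a] zv(1) fst_conv
      proof
        fix m assume m: "m \<in> {1..k}"
        show "inv' (a m) \<circ> (inv' \<zeta>' \<circ> \<zeta>) \<circ> a m \<in> W m"
          unfolding key[OF zv(2-4) m]
          by (intro perm_group.comp_in[OF groups[OF m]] perm_group.inv_in[OF groups[OF m]] w'(1) v_in zv m)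
      qed
    qed
    show "\<forall>p\<in>?F. to (inv' \<zeta>' \<circ> fst p) = p"
    proof
      fix p assume p: "p \<in> ?F"
      then obtain \<zeta> v where zv: "p = (\<zeta>, v)" "\<zeta> \<in> ?G" "v \<in> Pi\<^sub>E {1..k} W"
        "place a (\<zeta>, v) = place a (\<zeta>', w')" by blast
      have eta: "inv' \<zeta>' \<circ> \<zeta> \<in> ?G" using zv z by (intro sym_group_closed)
      have "(\<lambda>m\<in>{1..k}. inv' (a m) \<circ> inv' (inv' \<zeta>' \<circ> \<zeta>) \<circ> a m \<circ> w' m) = v"
      proof (rule extensionalityI[where A = "{1..k}"])
        show "v \<in> extensional {1..k}" using zv(3) by (simp add: PiE_def)
        fix m assume m: "m \<in> {1..k}"
        have v: "v m \<in> ?G" using v_in[OF zv(3) m] perm_group.in_sym[OF groups[OF m]] by blast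
        have "inv' (a m) \<circ> inv' (inv' \<zeta>' \<circ> \<zeta>) \<circ> a m \<circ> w' m = inv' (w' m \<circ> inv' (v m)) \<circ> w' m"
          by (simp only: conj_inv[OF a m eta] key[OF zv(2-4) m])
        also have "\<dots> = v m"
          using v w'(2)[OF m]
          by (simp add: sym_group_inv_comp[of _ d] sym_group_closed sym_group_cancel[of _ d] comp_assoc)
        finally show "(\<lambda>m\<in>{1..k}. inv' (a m) \<circ> inv' (inv' \<zeta>' \<circ> \<zeta>) \<circ> a m \<circ> w' m) m = v m"
          using m by (simp del: atLeastAtMost_iff comp_apply)
      qed simp
      then show "to (inv' \<zeta>' \<circ> fst p) = p"
        by (simp add: to_def zv(1) sym_group_cancel[OF z])
    qed
  qed
  then show ?thesis by (rule bij_betw_same_card[symmetric])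
qed

text \<open>Orbit and stabilizer: the parameter set, of the size on the right, splits into fibres of
  equal size over the class.\<close>

lemma card_superposition:
  assumes a: "a \<in> placements"
  shows "card (sup_rel d k W `` {a}) * card (sup_aut k W a) = fact d * (\<Prod>m\<in>{1..k}. card (W m))"
proof -
  let ?D = "carrier (sym_group d) \<times> Pi\<^sub>E {1..k} W"
  have cls: "sup_rel d k W `` {a} = place a ` ?D" using a sup_rel_iff by blast
  have fin: "finite ?D"
    using perm_group.finite[OF groups] finite_sym_group by (intro finite_cartesian_product finite_PiE) auto
  have "card ?D = (\<Sum>b\<in>place a ` ?D. card {p \<in> ?D. place a p = b})"
    using sum.image_gen[OF fin, of "\<lambda>_. 1::nat" "place a"] by (simp only: card_eq_sum)
  also have "\<dots> = (\<Sum>b\<in>place a ` ?D. card (sup_aut k W a))"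
    by (rule sum.cong[OF refl]) (use card_fibre_place[OF a] in auto)
  also have "\<dots> = card (sup_rel d k W `` {a}) * card (sup_aut k W a)" by (simp add: cls)
  finally show ?thesis by (simp add: card_cartesian_product card_PiE card_sym_group)
qed

lemma finite_placements: "finite placements"
  using finite_sym_group by (intro finite_PiE) auto

text \<open>Weighting placements by the order of their automorphism group gives every class the same
  total, so the weighted sum counts classes. The predicate has to be constant on classes.\<close>

lemma sum_placements_eq_card_superpositions:
  fixes P :: "(nat \<Rightarrow> nat \<Rightarrow> nat) \<Rightarrow> bool"
  assumes P: "\<And>a b. (a, b) \<in> sup_rel d k W \<Longrightarrow> P a \<longleftrightarrow> P b"
  shows "(\<Sum>a\<in>placements. if P a then card (sup_aut k W a) else 0) =
    card {S \<in> superpositions d k W. \<exists>a\<in>S. P a} * (fact d * (\<Prod>m\<in>{1..k}. card (W m)))"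
proof -
  let ?r = "sup_rel d k W" and ?N = "fact d * (\<Prod>m\<in>{1..k}. card (W m))"
  let ?f = "\<lambda>a. if P a then card (sup_aut k W a) else 0"
  note eq = equiv_sup_rel
  have sub: "S \<subseteq> placements" if "S \<in> placements // ?r" for S
    using in_quotient_imp_subset[OF eq that] .
  have fin: "finite (placements // ?r)"
    using finite_placements by (rule finite_quotient) (use eq in \<open>simp add: equiv_def\<close>)
  \<comment> \<open>Written over the union of the classes so that the sum can be split; that this
    union is all of \<open>placements\<close> is used at the end.\<close>
  have "(\<Sum>a\<in>\<Union>(placements // ?r). ?f a) = (\<Sum>S\<in>placements // ?r. \<Sum>a\<in>S. ?f a)"
    using finite_subset[OF sub finite_placements] quotient_disj[OF eq]
    by (subst sum.Union_disjoint) (blast, blast, simp)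
  also have "\<dots> = (\<Sum>S\<in>placements // ?r. if \<exists>a\<in>S. P a then ?N else 0)"
  proof (rule sum.cong[OF refl])
    fix S assume S: "S \<in> placements // ?r"
    then obtain a where a: "a \<in> placements" "S = ?r `` {a}" by (rule quotientE)
    have aS: "a \<in> S" using equiv_class_self[OF eq a(1)] a(2) by simp
    have rel: "(a, b) \<in> ?r" if "b \<in> S" for b using that a(2) by simp
    have Pa: "P b \<longleftrightarrow> P a" if "b \<in> S" for b using P[OF rel[OF that]] by simp
    have card_eq: "card (sup_aut k W b) = card (sup_aut k W a)" if "b \<in> S" for b
      using card_sup_aut_cong[OF rel[OF that] perm_group.subgroup[OF groups]] .
    have "(\<Sum>b\<in>S. ?f b) = (\<Sum>b\<in>S. ?f a)" using Pa card_eq by (intro sum.cong) auto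
    also have "\<dots> = (if P a then ?N else 0)" using card_superposition[OF a(1)] a(2) by simp
    also have "P a \<longleftrightarrow> (\<exists>a\<in>S. P a)" using Pa aS by blast
    finally show "(\<Sum>b\<in>S. ?f b) = (if \<exists>a\<in>S. P a then ?N else 0)" .
  qed
  also have "\<dots> = card {S \<in> placements // ?r. \<exists>a\<in>S. P a} * ?N"
    using fin by (simp add: sum.inter_filter[symmetric])
  finally show ?thesis using Union_quotient[OF eq] by (simp add: superpositions_def)
qed

text \<open>Expanding a product of k sums over the symmetric group means choosing one g for each m,
  which is a placement. Its term at \<open>\<sigma>\<close> survives exactly when every conjugate
  lies in \<open>W m\<close>, that is, for \<open>\<sigma>\<close> in the automorphism
  group.\<close>

lemma sum_prod_ind_char:
  fixes \<chi> :: "nat \<Rightarrow> (nat \<Rightarrow> nat) \<Rightarrow> 'a::field_char_0"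
  shows "(\<Sum>\<sigma>\<in>carrier (sym_group d). \<Prod>m\<in>{1..k}. ind_char d (W m) (\<chi> m) \<sigma>) =
    (\<Sum>a\<in>placements. \<Sum>\<sigma>\<in>sup_aut k W a. \<Prod>m\<in>{1..k}. \<chi> m (inv' (a m) \<circ> \<sigma> \<circ> a m)) /
    (\<Prod>m\<in>{1..k}. of_nat (card (W m)))"
proof -
  let ?G = "carrier (sym_group d)"
  define f where "f m x = (if x \<in> W m then \<chi> m x else 0)" for m x
  have "(\<Sum>\<sigma>\<in>?G. \<Prod>m\<in>{1..k}. ind_char d (W m) (\<chi> m) \<sigma>) =
      (\<Sum>\<sigma>\<in>?G. (\<Prod>m\<in>{1..k}. \<Sum>g\<in>?G. f m (inv' g \<circ> \<sigma> \<circ> g)) / (\<Prod>m\<in>{1..k}. of_nat (card (W m))))"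
    by (simp add: ind_char_def f_def prod_dividef)
  also have "\<dots> = (\<Sum>\<sigma>\<in>?G. \<Prod>m\<in>{1..k}. \<Sum>g\<in>?G. f m (inv' g \<circ> \<sigma> \<circ> g)) / (\<Prod>m\<in>{1..k}. of_nat (card (W m)))"
    by (simp add: sum_divide_distrib)
  also have "(\<Sum>\<sigma>\<in>?G. \<Prod>m\<in>{1..k}. \<Sum>g\<in>?G. f m (inv' g \<circ> \<sigma> \<circ> g)) =
      (\<Sum>\<sigma>\<in>?G. \<Sum>a\<in>placements. \<Prod>m\<in>{1..k}. f m (inv' (a m) \<circ> \<sigma> \<circ> a m))"
    by (subst prod_sum_PiE) (simp_all add: finite_sym_group)
  also have "\<dots> = (\<Sum>a\<in>placements. \<Sum>\<sigma>\<in>?G. \<Prod>m\<in>{1..k}. f m (inv' (a m) \<circ> \<sigma> \<circ> a m))"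
    by (rule sum.swap)
  also have "\<dots> = (\<Sum>a\<in>placements. \<Sum>\<sigma>\<in>sup_aut k W a. \<Prod>m\<in>{1..k}. \<chi> m (inv' (a m) \<circ> \<sigma> \<circ> a m))"
  proof (rule sum.cong[OF refl])
    fix a assume a: "a \<in> placements"
    show "(\<Sum>\<sigma>\<in>?G. \<Prod>m\<in>{1..k}. f m (inv' (a m) \<circ> \<sigma> \<circ> a m)) =
        (\<Sum>\<sigma>\<in>sup_aut k W a. \<Prod>m\<in>{1..k}. \<chi> m (inv' (a m) \<circ> \<sigma> \<circ> a m))"
    proof (rule sum.mono_neutral_cong_right)
      show "sup_aut k W a \<subseteq> ?G" using perm_group.in_sym[OF perm_group_sup_aut[OF a]] by blast
      show "\<forall>\<sigma>\<in>?G - sup_aut k W a. (\<Prod>m\<in>{1..k}. f m (inv' (a m) \<circ> \<sigma> \<circ> a m)) = 0"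
      proof
        fix \<sigma> assume "\<sigma> \<in> ?G - sup_aut k W a"
        then obtain m where "m \<in> {1..k}" "inv' (a m) \<circ> \<sigma> \<circ> a m \<notin> W m"
          using mem_sup_aut[OF a] by blast
        then show "(\<Prod>m\<in>{1..k}. f m (inv' (a m) \<circ> \<sigma> \<circ> a m)) = 0"
          by (intro prod_zero finite_atLeastAtMost bexI[of _ m]) (simp_all add: f_def)
      qed
      fix \<sigma> assume "\<sigma> \<in> sup_aut k W a"
      then show "(\<Prod>m\<in>{1..k}. f m (inv' (a m) \<circ> \<sigma> \<circ> a m)) = (\<Prod>m\<in>{1..k}. \<chi> m (inv' (a m) \<circ> \<sigma> \<circ> a m))"
        using sup_aut_conj_in[OF a] by (intro prod.cong refl) (simp add: f_def)
    qed (rule finite_sym_group)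
  qed
  finally show ?thesis .
qed

lemma linear_char_conj:
  assumes \<chi>: "linear_char d (W m) \<chi>" and a: "a \<in> placements" and m: "m \<in> {1..k}"
  shows "linear_char d (sup_aut k W a) (\<lambda>\<sigma>. \<chi> (inv' (a m) \<circ> \<sigma> \<circ> a m))"
  unfolding linear_char_def
proof (rule homI)
  fix \<sigma> assume "\<sigma> \<in> carrier (subgrp d (sup_aut k W a))"
  then have s: "\<sigma> \<in> sup_aut k W a" by (simp add: subgrp_def)
  show "\<chi> (inv' (a m) \<circ> \<sigma> \<circ> a m) \<in> carrier units_group"
    using linear_char_nonzero[OF \<chi> sup_aut_conj_in[OF a s m]] by (simp add: units_group_def)
  fix \<tau> assume "\<tau> \<in> carrier (subgrp d (sup_aut k W a))"
  then have t: "\<tau> \<in> sup_aut k W a" by (simp add: subgrp_def)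
  show "\<chi> (inv' (a m) \<circ> (\<sigma> \<otimes>\<^bsub>subgrp d (sup_aut k W a)\<^esub> \<tau>) \<circ> a m) =
      \<chi> (inv' (a m) \<circ> \<sigma> \<circ> a m) \<otimes>\<^bsub>units_group\<^esub> \<chi> (inv' (a m) \<circ> \<tau> \<circ> a m)"
    using linear_char_mult[OF \<chi> sup_aut_conj_in[OF a s m] sup_aut_conj_in[OF a t m]]
    by (simp add: subgrp_def units_group_def sym_group_mult conj_comp[OF a m])
qed

text \<open>Conjugation by \<open>a m\<close> moves the automorphism group into \<open>W m\<close>
  without changing its order, and there the coprimality criterion applies.\<close>

lemma card_sup_aut_dvd_iff:
  assumes R: "R \<lhd> subgrp d (W m)" and cop: "coprime (order (subgrp d (W m) Mod R)) (card R)"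
    and a: "a \<in> placements" and m: "m \<in> {1..k}"
  shows "card (sup_aut k W a) dvd card R \<longleftrightarrow> (\<forall>\<sigma>\<in>sup_aut k W a. inv' (a m) \<circ> \<sigma> \<circ> a m \<in> R)"
proof -
  interpret Wm: perm_group d "W m" by (rule groups[OF m])
  interpret A: perm_group d "sup_aut k W a" by (rule perm_group_sup_aut[OF a])
  interpret G: group "sym_group d" by (rule sym_group_is_group)
  interpret WG: group "subgrp d (W m)"
    unfolding subgrp_def by (rule subgroup.subgroup_is_group[OF Wm.subgroup G.group_axioms])
  note am = placement_in_sym[OF a m]
  let ?c = "\<lambda>\<sigma>. inv' (a m) \<circ> \<sigma> \<circ> a m"
  let ?H = "?c ` sup_aut k W a"
  have sub: "?H \<subseteq> W m" using sup_aut_conj_in[OF a _ m] by blast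
  have "perm_group d ?H"
  proof (rule perm_groupI)
    show "?H \<subseteq> carrier (sym_group d)" using sub Wm.in_sym by blast
    show "id \<in> ?H"
      by (rule image_eqI[OF _ A.id_in]) (simp add: sym_group_cancel[OF am])
    fix v assume "v \<in> ?H"
    then obtain \<sigma> where s: "\<sigma> \<in> sup_aut k W a" "v = ?c \<sigma>" by blast
    show "inv' v \<in> ?H"
      unfolding s(2) conj_inv[OF a m A.in_sym[OF s(1)], symmetric] by (rule imageI[OF A.inv_in[OF s(1)]])
    fix w assume "w \<in> ?H"
    then obtain \<tau> where t: "\<tau> \<in> sup_aut k W a" "w = ?c \<tau>" by blast
    show "v \<circ> w \<in> ?H"
      unfolding s(2) t(2) conj_comp[OF a m, symmetric] by (rule imageI[OF A.comp_in[OF s(1) t(1)]])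
  qed
  then have "subgroup ?H (subgrp d (W m))"
    unfolding subgrp_def
    by (intro G.subgroup_incl Wm.subgroup sub perm_group.subgroup)
  then have "card ?H dvd card R \<longleftrightarrow> ?H \<subseteq> R"
    using Wm.finite by (intro WG.card_dvd_iff_subset_normal R cop) (simp_all add: subgrp_def)
  moreover have "inj_on ?c (sup_aut k W a)"
    by (rule inj_on_inverseI[where g = "\<lambda>x. a m \<circ> x \<circ> inv' (a m)"])
       (simp add: comp_assoc sym_group_cancel[OF am])
  ultimately show ?thesis by (auto simp: card_image)
qed

end

section \<open>The coefficient sum as a number of superpositions\<close>

theorem corollary3p2p2:
  fixes d k r :: nat
    and \<Gamma> :: "nat \<Rightarrow> nat uprod multiset"
    and W :: "nat \<Rightarrow> (nat \<Rightarrow> nat) set"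
    and R :: "(nat \<Rightarrow> nat) set"
    and \<pi> :: "(nat \<Rightarrow> nat) \<Rightarrow> 'k::{alg_closed_field, field_char_0}"
  assumes "d \<ge> 1" and "k \<ge> 1"
    and "\<And>m. m \<in> {1..k} \<Longrightarrow> is_graph d (\<Gamma> m)"
    and "\<And>m. m \<in> {1..k} \<Longrightarrow> W m = graph_aut d (\<Gamma> m)"
    and "R \<lhd> subgrp d (W 1)"
    and "solvable (subgrp d R)"
    and "card R = r"
    and "cyclic_group (subgrp d (W 1) Mod R)"
    and "coprime (order (subgrp d (W 1) Mod R)) r"
    and "linear_char d (W 1) \<pi>"
    and "kernel (subgrp d (W 1)) units_group \<pi> = R"
  shows "of_nat (card {S \<in> superpositions d k W. \<exists>a\<in>S. card (sup_aut k W a) dvd r}) =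
    coeff_sum (psum_poly d
      (foldl (internal_prod d) (cycle_index d (W 1) \<pi>)
        (map (\<lambda>m. cycle_index d (W m) (\<lambda>_. 1)) [2..<Suc k])))"
proof -
  interpret perm_groups d k W
  proof (rule perm_groups.intro)
    show "perm_group d (W m)" if "m \<in> {1..k}" for m
      unfolding assms(4)[OF that] by (rule perm_group_graph_aut)
  qed (rule assms(2))
  let ?G = "carrier (sym_group d)"
  let ?P = "\<lambda>a. card (sup_aut k W a) dvd r"
  have 1: "1 \<in> {1..k}" using assms(2) by simp
  \<comment> \<open>One family of characters, so that the distinguished first factor and the trivial
    ones are treated alike.\<close>
  define \<chi> where "\<chi> m = (if m = 1 then \<pi> else (\<lambda>_. 1))" for m :: nat
  have \<chi>: "linear_char d (W m) (\<chi> m)" if "m \<in> {1..k}" for m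
    using assms(10) by (simp add: \<chi>_def perm_group.linear_char_one[OF groups[OF that]])
  define u where "u m = ind_char d (W m) (\<chi> m)" for m
  have u: "u m \<in> sym_chars d" if "m \<in> {1..k}" for m
    unfolding u_def by (rule perm_group.ind_char_in_sym_chars[OF groups[OF that] \<chi>[OF that]])
  have ci: "cycle_index d (W m) (\<chi> m) = ch d (u m)" if "m \<in> {1..k}" for m
    unfolding u_def by (rule perm_group.cycle_index_eq_ch_ind_char[OF groups[OF that]])
  \<comment> \<open>The fold starts from factor 1 and its list holds the indices from 2 to k; for k
    = 1 the list is empty.\<close>
  have split: "{1..k} = insert 1 {2..<Suc k}" using assms(2) by auto
  have maps: "map (\<lambda>m. cycle_index d (W m) (\<lambda>_. 1)) [2..<Suc k] = map (\<lambda>m. ch d (u m)) [2..<Suc k]"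
  proof (rule map_cong[OF refl])
    fix m assume "m \<in> set [2..<Suc k]"
    then have "m \<in> {1..k}" "m \<noteq> 1" by auto
    then show "cycle_index d (W m) (\<lambda>_. 1) = ch d (u m)" using ci[of m] by (simp add: \<chi>_def)
  qed
  have "foldl (internal_prod d) (cycle_index d (W 1) \<pi>) (map (\<lambda>m. cycle_index d (W m) (\<lambda>_. 1)) [2..<Suc k])
      = foldl (internal_prod d) (ch d (u 1)) (map (\<lambda>m. ch d (u m)) [2..<Suc k])"
    unfolding maps using ci[OF 1] by (simp add: \<chi>_def)
  also have "\<dots> = ch d (\<lambda>\<sigma>\<in>?G. u 1 \<sigma> * prod_list (map (\<lambda>m. u m \<sigma>) [2..<Suc k]))"
  proof (rule foldl_internal_prod_ch)
    show "u m \<in> sym_chars d" if "m \<in> set [2..<Suc k]" for m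
      using that by (intro u) auto
  qed (rule u[OF 1])
  also have "(\<lambda>\<sigma>\<in>?G. u 1 \<sigma> * prod_list (map (\<lambda>m. u m \<sigma>) [2..<Suc k])) = (\<lambda>\<sigma>\<in>?G. \<Prod>m\<in>{1..k}. u m \<sigma>)"
  proof (rule restrict_ext)
    fix \<sigma>
    have "prod_list (map (\<lambda>m. u m \<sigma>) [2..<Suc k]) = (\<Prod>m\<in>{2..<Suc k}. u m \<sigma>)"
      using prod.distinct_set_conv_list[OF distinct_upt, of "\<lambda>m. u m \<sigma>" 2 "Suc k"] by (simp only: set_upt)
    then show "u 1 \<sigma> * prod_list (map (\<lambda>m. u m \<sigma>) [2..<Suc k]) = (\<Prod>m\<in>{1..k}. u m \<sigma>)"
      unfolding split by (subst prod.insert) auto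
  qed
  finally have "coeff_sum (psum_poly d (foldl (internal_prod d) (cycle_index d (W 1) \<pi>)
      (map (\<lambda>m. cycle_index d (W m) (\<lambda>_. 1)) [2..<Suc k]))) =
      (\<Sum>\<sigma>\<in>?G. \<Prod>m\<in>{1..k}. u m \<sigma>) / fact d" (is "?N = _")
    by (simp add: coeff_sum_psum_poly_ch)
  also have "(\<Sum>\<sigma>\<in>?G. \<Prod>m\<in>{1..k}. u m \<sigma>) =
      (\<Sum>a\<in>placements. \<Sum>\<sigma>\<in>sup_aut k W a. \<Prod>m\<in>{1..k}. \<chi> m (inv' (a m) \<circ> \<sigma> \<circ> a m)) /
      (\<Prod>m\<in>{1..k}. of_nat (card (W m)))"
    unfolding u_def by (rule sum_prod_ind_char)
  also have "(\<Sum>a\<in>placements. \<Sum>\<sigma>\<in>sup_aut k W a. \<Prod>m\<in>{1..k}. \<chi> m (inv' (a m) \<circ> \<sigma> \<circ> a m)) =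
      (\<Sum>a\<in>placements. of_nat (if ?P a then card (sup_aut k W a) else 0))"
  proof (rule sum.cong[OF refl])
    fix a assume a: "a \<in> placements"
    let ?c = "\<lambda>\<sigma>. inv' (a 1) \<circ> \<sigma> \<circ> a 1"
    have "(\<Prod>m\<in>{1..k}. \<chi> m (inv' (a m) \<circ> \<sigma> \<circ> a m)) = \<pi> (?c \<sigma>)" for \<sigma>
    proof -
      have "(\<Prod>m\<in>{1..k}. \<chi> m (inv' (a m) \<circ> \<sigma> \<circ> a m)) = (\<Prod>m\<in>{1}. \<chi> m (inv' (a m) \<circ> \<sigma> \<circ> a m))"
        using 1 by (intro prod.mono_neutral_right) (auto simp: \<chi>_def)
      then show ?thesis by (simp add: \<chi>_def)
    qed
    then have "(\<Sum>\<sigma>\<in>sup_aut k W a. \<Prod>m\<in>{1..k}. \<chi> m (inv' (a m) \<circ> \<sigma> \<circ> a m)) =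
        (\<Sum>\<sigma>\<in>sup_aut k W a. \<pi> (?c \<sigma>))" by simp
    also have "\<dots> = (if \<forall>\<sigma>\<in>sup_aut k W a. \<pi> (?c \<sigma>) = 1 then of_nat (card (sup_aut k W a)) else 0)"
      by (rule perm_group.sum_linear_char[OF perm_group_sup_aut[OF a] linear_char_conj[OF assms(10) a 1]])
    \<comment> \<open>The conjugates already lie in \<open>W 1\<close>, so having value 1 is the
      same as lying in the kernel of \<open>\<pi>\<close>.\<close>
    also have "(\<forall>\<sigma>\<in>sup_aut k W a. \<pi> (?c \<sigma>) = 1) \<longleftrightarrow> (\<forall>\<sigma>\<in>sup_aut k W a. ?c \<sigma> \<in> R)"
      using sup_aut_conj_in[OF a _ 1]
      by (intro ball_cong refl) (simp add: assms(11)[symmetric] kernel_def subgrp_def units_group_def)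
    also have "\<dots> \<longleftrightarrow> ?P a"
      using card_sup_aut_dvd_iff[OF assms(5) _ a 1] assms(7,9) by simp
    finally show "(\<Sum>\<sigma>\<in>sup_aut k W a. \<Prod>m\<in>{1..k}. \<chi> m (inv' (a m) \<circ> \<sigma> \<circ> a m)) =
        of_nat (if ?P a then card (sup_aut k W a) else 0)"
      by (simp only: if_distrib[where f = of_nat] of_nat_0)
  qed
  also have "\<dots> = of_nat (\<Sum>a\<in>placements. if ?P a then card (sup_aut k W a) else 0)"
    by (rule of_nat_sum[symmetric])
  also have "(\<Sum>a\<in>placements. if ?P a then card (sup_aut k W a) else 0) =
      card {S \<in> superpositions d k W. \<exists>a\<in>S. ?P a} * (fact d * (\<Prod>m\<in>{1..k}. card (W m)))"
    using card_sup_aut_cong[OF _ perm_group.subgroup[OF groups]]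
    by (intro sum_placements_eq_card_superpositions) simp
  finally have "?N = of_nat (card {S \<in> superpositions d k W. \<exists>a\<in>S. ?P a} * (fact d * (\<Prod>m\<in>{1..k}. card (W m)))) /
      (\<Prod>m\<in>{1..k}. of_nat (card (W m))) / fact d" .
  then have "?N = of_nat (card {S \<in> superpositions d k W. \<exists>a\<in>S. ?P a}) *
      (fact d * (\<Prod>m\<in>{1..k}. of_nat (card (W m)))) / (\<Prod>m\<in>{1..k}. of_nat (card (W m))) / fact d"
    by (simp only: of_nat_mult of_nat_fact of_nat_prod)
  \<comment> \<open>Each group contains the identity, so its order is positive and remains nonzero
    in characteristic zero, which permits the cancellation.\<close>
  moreover have "(\<Prod>m\<in>{1..k}. of_nat (card (W m))) \<noteq> (0::'k)"
    using perm_group.card_pos[OF groups] by (auto simp: prod_zero_iff)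
  ultimately show ?thesis by (simp only: mult.assoc[symmetric] nonzero_mult_div_cancel_right fact_nonzero not_False_eq_True)
qed

end
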